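(* Let $\mathcal X,\mathcal Y$ be countable sets, $\lambda>0$, and let $c\colon\mathcal X\times\mathcal Y\to\mathbb R$ admit two (possibly identical) collections of dominating functions with weights $\mathcal C_{\mathcal X},\mathcal C_{\mathcal Y},\phi_{\mathcal X},\phi_{\mathcal Y}$ and $\tilde{\mathcal C}_{\mathcal X},\tilde{\mathcal C}_{\mathcal Y},\tilde\phi_{\mathcal X},\tilde\phi_{\mathcal Y}$. Let $r\in\mathcal P(\mathcal X)$, $s\in\mathcal P(\mathcal Y)$ with $\mathcal C_{\mathcal X},\tilde{\mathcal C}_{\mathcal X},\tilde\phi_{\mathcal X}\in\ell^1_r(\mathcal X)$ and $\mathcal C_{\mathcal Y},\tilde{\mathcal C}_{\mathcal Y},\phi_{\mathcal Y}\in\ell^1_s(\mathcal Y)$, and let $\mathcal F_{\mathcal X},\mathcal F_{\mathcal Y}$ be the function classes defined in the context. Then the functional $$EROT^\lambda\colon\big(\mathcal P(\mathcal X)\cap\ell^\infty(\mathcal F_{\mathcal X})\big)\times\big(\mathcal P(\mathcal Y)\cap\ell^\infty(\mathcal F_{\mathcal Y})\big)\to\mathbb R$$ is Hadamard differentiable at $(r,s)$ tangentially to $\big(\mathcal P(\mathcal X)\cap\ell^\infty(\mathcal F_{\mathcal X})\big)\times\big(\mathcal P(\mathcal Y)\cap\ell^\infty(\mathcal F_{\mathcal Y})\big)$, with Hadamard derivative $$T_{(r,s)}\Big(\big(\mathcal P(\mathcal X)\cap\ell^\infty(\mathcal F_{\mathcal X})\big)\times\big(\mathcal P(\mathcal Y)\cap\ell^\infty(\mathcal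 F_{\mathcal Y})\big)\Big)\to\mathbb R,\qquad(h^{\mathcal X},h^{\mathcal Y})\mapsto\langle\alpha^\lambda,h^{\mathcal X}\rangle+\langle\beta^\lambda,h^{\mathcal Y}\rangle,$$ where $(\alpha^\lambda,\beta^\lambda)$ are EROT potentials for $(r,s)$.
   Context: $\mathcal P(\mathcal X)$: probability measures $r=(r_x)$ on $\mathcal X$; $\ell^1_r(\mathcal X)$: functions with finite expectation under $r$; $\langle f,r\rangle=\sum_xf(x)r_x$. Enumerate $\mathcal X=\{x_1,x_2,\dots\}$, $\mathcal Y=\{y_1,y_2,\dots\}$. EROT: $\Pi(r,s)$ is the set of couplings; $M(\pi)=\sum_{x,y}\pi_{xy}\log(\pi_{xy}/(r_xs_y))$; $EROT^\lambda(r,s)=\inf_{\pi\in\Pi(r,s)}\langle c,\pi\rangle+\lambda M(\pi)$. EROT potentials are maximizers $(\alpha,\beta)\in\ell^1_r(\mathcal X)\times\ell^1_s(\mathcal Y)$ of $\langle\alpha,r\rangle+\langle\beta,s\rangle-\lambda\sum_{x,y}[\exp((\alpha_x+\beta_y-c(x,y))/\lambda)r_xs_y-r_xs_y]$ (unique on the supports up to a shift $(\alpha+\eta,\beta-\eta)$), extended outside $\mathrm{supp}(r)$, $\mathrm{supp}(s)$ by $\alpha_x=-\lambda\log\sum_y\exp((\beta_y-c(x,y))/\lambda)s_y$ and $\beta_y=-\lambda\log\sum_x\exp((\alpha_x-c(x,y))/\lambda)r_x$ (these identities hold automatically on the supports). Dominating functions for $c$: real functions $c_{\mathcal X}^-\le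 c_{\mathcal X}^+$, $c_{\mathcal Y}^-\le c_{\mathcal Y}^+$ with $c_{\mathcal X}^-(x)+c_{\mathcal Y}^-(y)\le c(x,y)\le c_{\mathcal X}^+(x)+c_{\mathcal Y}^+(y)$. Weights: $\mathcal C_{\mathcal X}=1+|c_{\mathcal X}^+|+|c_{\mathcal X}^-|$, $\mathcal C_{\mathcal Y}=1+|c_{\mathcal Y}^+|+|c_{\mathcal Y}^-|$, $\phi_{\mathcal X}=\exp((c_{\mathcal X}^+-c_{\mathcal X}^-)/\lambda)$, $\phi_{\mathcal Y}=\exp((c_{\mathcal Y}^+-c_{\mathcal Y}^-)/\lambda)$; the second collection's weights carry a tilde. Function classes: $\mathcal F_{\mathcal X}=\{f:|f|\le\mathcal C_{\mathcal X}\}\cup\{\tilde{\mathcal C}_{\mathcal X}\}\cup\{\tilde\phi_{\mathcal X}\}\cup\{\tilde\phi_{\mathcal X}\mathbf 1_{\mathcal X\setminus\{x_1,\dots,x_n\}}:n\in\mathbb N\}$, $\mathcal F_{\mathcal Y}=\{f:|f|\le\tilde{\mathcal C}_{\mathcal Y}\}\cup\{\mathcal C_{\mathcal Y}\}\cup\{\phi_{\mathcal Y}\}\cup\{\phi_{\mathcal Y}\mathbf 1_{\mathcal Y\setminus\{y_1,\dots,y_n\}}:n\in\mathbb N\}$. $\ell^\infty(\mathcal F)$ is the Banach space of bounded functionals on $\mathcal F$ with sup norm; a measure is viewed in $\ell^\infty(\mathcal F)$ via $f\mapsto\langle f,r\rangle$, and $\mathcal P(\mathcal X)\cap\ell^\infty(\mathcal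 F_{\mathcal X})$ is the set of probability measures for which this is a well-defined bounded functional. Elements $h^{\mathcal X}$, $h^{\mathcal Y}$ of the contingent cone below are identified with signed measures in $\ell^1_{\mathcal C_{\mathcal X}}(\mathcal X)$, resp. $\ell^1_{\tilde{\mathcal C}_{\mathcal Y}}(\mathcal Y)$ (where $\ell^1_f$ has norm $\sum f|a|$), through their values on $\{|f|\le\mathcal C_{\mathcal X}\}$, resp. $\{|f|\le\tilde{\mathcal C}_{\mathcal Y}\}$, and the pairings are the corresponding sums. Hadamard differentiability: for normed spaces $U,V$, $U_0\subseteq U$, $u\in U_0$, a map $\Psi$ into $V$ defined on $U_0$ is Hadamard differentiable at $u$ tangentially to $U_0$ if there is a continuous linear map $\mathcal D^H_{|u}\Psi$ such that $\|t_n^{-1}(\Psi(u+t_nh_n)-\Psi(u))-\mathcal D^H_{|u}\Psi(h)\|_V\to0$ for all $t_n\searrow0$ and all $h_n=t_n^{-1}(k_n-u)$, $k_n\in U_0$, converging to $h$; the derivative is defined on the contingent cone $T_u(U_0)=\{h\in U:h=\lim t_n^{-1}(k_n-u),\ k_n\in U_0,\ t_n\searrow0\}$. *)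

theory Defs
  imports "HOL-Probability.Probability" "HOL-Probability.Discrete_Topology"
begin

subsection \<open>Weighted sequence spaces and pairings\<close>

text \<open>
  The set \<open>ell1 w\<close> is used in both roles of the notation: with a probability vector as weight it
  consists of the functions with finite expectation, and with a weight function \<open>w \<ge> 1\<close> it
  consists of the signed measures \<open>a\<close> with \<open>\<Sum>\<^sub>x w x * \<bar>a x\<bar> < \<infinity>\<close>.
\<close>

definition ell1 :: "('a \<Rightarrow> real) \<Rightarrow> ('a \<Rightarrow> real) set" where
  "ell1 w = {a. (\<lambda>x. w x * \<bar>a x\<bar>) summable_on UNIV}"

definition pairing :: "('a \<Rightarrow> real) \<Rightarrow> ('a \<Rightarrow> real) \<Rightarrow> real" where
  "pairing f a = (\<Sum>\<^sub>\<infinity>x. f x * a x)"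


subsection \<open>Entropy regularized optimal transport\<close>

definition couplings :: "'x pmf \<Rightarrow> 'y pmf \<Rightarrow> ('x \<times> 'y) pmf set" where
  "couplings r s = {\<pi>. map_pmf fst \<pi> = r \<and> map_pmf snd \<pi> = s}"

text \<open>
  Each sum below has a summable negative part: \<open>p * ln (p / q) \<ge> p - q\<close> in the mutual
  information and \<open>exp t * q - q \<ge> - q\<close> in the dual objective. So failure of summability
  means precisely that the sum is \<open>+\<infinity>\<close>. The convention \<open>0 * ln 0 = 0\<close> is automatic,
  and \<open>pmf \<pi> (x, y) = 0\<close> for a coupling whenever \<open>pmf r x * pmf s y = 0\<close>.
\<close>

definition mutual_info :: "'x pmf \<Rightarrow> 'y pmf \<Rightarrow> ('x \<times> 'y) pmf \<Rightarrow> ereal" where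
  "mutual_info r s \<pi> =
    (let m = (\<lambda>(x, y). pmf \<pi> (x, y) * ln (pmf \<pi> (x, y) / (pmf r x * pmf s y)))
     in if m summable_on UNIV then ereal (\<Sum>\<^sub>\<infinity>z. m z) else \<infinity>)"

definition EROT :: "real \<Rightarrow> ('x \<Rightarrow> 'y \<Rightarrow> real) \<Rightarrow> 'x pmf \<Rightarrow> 'y pmf \<Rightarrow> real" where
  "EROT lam c r s = real_of_ereal
    (INF \<pi>\<in>couplings r s.
       ereal (pairing (\<lambda>(x, y). c x y) (pmf \<pi>)) + ereal lam * mutual_info r s \<pi>)"

definition dual_objective ::
    "real \<Rightarrow> ('x \<Rightarrow> 'y \<Rightarrow> real) \<Rightarrow> 'x pmf \<Rightarrow> 'y pmf \<Rightarrow> ('x \<Rightarrow> real) \<Rightarrow> ('y \<Rightarrow> real) \<Rightarrow> ereal" where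
  "dual_objective lam c r s \<alpha> \<beta> =
    (let e = (\<lambda>(x, y). exp ((\<alpha> x + \<beta> y - c x y) / lam) * (pmf r x * pmf s y) - pmf r x * pmf s y)
     in if e summable_on UNIV
        then ereal (pairing \<alpha> (pmf r) + pairing \<beta> (pmf s) - lam * (\<Sum>\<^sub>\<infinity>z. e z))
        else - \<infinity>)"

definition EROT_potentials ::
    "real \<Rightarrow> ('x \<Rightarrow> 'y \<Rightarrow> real) \<Rightarrow> 'x pmf \<Rightarrow> 'y pmf \<Rightarrow> ('x \<Rightarrow> real) \<Rightarrow> ('y \<Rightarrow> real) \<Rightarrow> bool" where
  "EROT_potentials lam c r s \<alpha> \<beta> \<longleftrightarrow>
     \<alpha> \<in> ell1 (pmf r) \<and> \<beta> \<in> ell1 (pmf s) \<and>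
     (\<forall>\<alpha>'\<in>ell1 (pmf r). \<forall>\<beta>'\<in>ell1 (pmf s).
        dual_objective lam c r s \<alpha>' \<beta>' \<le> dual_objective lam c r s \<alpha> \<beta>) \<and>
     (\<forall>x. x \<notin> set_pmf r \<longrightarrow>
        \<alpha> x = - lam * ln (\<Sum>\<^sub>\<infinity>y. exp ((\<beta> y - c x y) / lam) * pmf s y)) \<and>
     (\<forall>y. y \<notin> set_pmf s \<longrightarrow>
        \<beta> y = - lam * ln (\<Sum>\<^sub>\<infinity>x. exp ((\<alpha> x - c x y) / lam) * pmf r x))"


subsection \<open>Dominating functions and function classes\<close>

definition dominating ::
    "('x \<Rightarrow> 'y \<Rightarrow> real) \<Rightarrow> ('x \<Rightarrow> real) \<Rightarrow> ('x \<Rightarrow> real) \<Rightarrow> ('y \<Rightarrow> real) \<Rightarrow> ('y \<Rightarrow> real) \<Rightarrow> bool" where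
  "dominating c cXm cXp cYm cYp \<longleftrightarrow>
     (\<forall>x. cXm x \<le> cXp x) \<and> (\<forall>y. cYm y \<le> cYp y) \<and>
     (\<forall>x y. cXm x + cYm y \<le> c x y \<and> c x y \<le> cXp x + cYp y)"

definition abs_weight :: "('a \<Rightarrow> real) \<Rightarrow> ('a \<Rightarrow> real) \<Rightarrow> 'a \<Rightarrow> real" where
  "abs_weight cm cp = (\<lambda>z. 1 + \<bar>cp z\<bar> + \<bar>cm z\<bar>)"

definition exp_weight :: "real \<Rightarrow> ('a \<Rightarrow> real) \<Rightarrow> ('a \<Rightarrow> real) \<Rightarrow> 'a \<Rightarrow> real" where
  "exp_weight lam cm cp = (\<lambda>z. exp ((cp z - cm z) / lam))"

text \<open>The enumeration \<open>e\<close> is indexed from \<open>0\<close>, so \<open>e ` {..<n}\<close> is the set of the first \<open>n\<close> points.\<close>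

definition function_class ::
    "('a \<Rightarrow> real) \<Rightarrow> ('a \<Rightarrow> real) \<Rightarrow> ('a \<Rightarrow> real) \<Rightarrow> (nat \<Rightarrow> 'a) \<Rightarrow> ('a \<Rightarrow> real) set" where
  "function_class C C' \<phi> e =
     {f. \<forall>z. \<bar>f z\<bar> \<le> C z} \<union> {C'} \<union> {\<phi>} \<union> range (\<lambda>n z. \<phi> z * indicator (- (e ` {..<n})) z)"


subsection \<open>Bounded functionals on a function class\<close>

text \<open>
  The space of all bounded functionals on \<open>'a \<Rightarrow> real\<close> with the supremum norm is the type of
  bounded continuous functions on the discrete space. The Banach space of bounded functionals on a
  class \<open>F\<close> is the closed, isometrically embedded subspace of the elements that vanish outside \<open>F\<close>.
\<close>

type_synonym 'a functional = "('a \<Rightarrow> real) discrete \<Rightarrow>\<^sub>C real"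

definition prob_linf :: "('a \<Rightarrow> real) set \<Rightarrow> 'a pmf set" where
  "prob_linf F = {r. F \<subseteq> ell1 (pmf r) \<and> bounded ((\<lambda>f. pairing f (pmf r)) ` F)}"

definition as_functional :: "('a \<Rightarrow> real) set \<Rightarrow> 'a pmf \<Rightarrow> 'a functional" where
  "as_functional F r =
     Bcontfun (\<lambda>d. if of_discrete d \<in> F then pairing (of_discrete d) (pmf r) else 0)"

lemma apply_as_functional:
  assumes "r \<in> prob_linf F"
  shows "apply_bcontfun (as_functional F r) (discrete f) = (if f \<in> F then pairing f (pmf r) else 0)"
proof -
  let ?g = "\<lambda>d. if of_discrete d \<in> F then pairing (of_discrete d) (pmf r) else 0"
  have "bounded (insert 0 ((\<lambda>f. pairing f (pmf r)) ` F))"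
    using assms by (simp add: prob_linf_def)
  then have "bounded (range ?g)"
    by (rule bounded_subset) auto
  moreover have "continuous_on UNIV ?g"
    by (simp add: continuous_on_open_vimage Discrete_Topology.open_discrete)
  ultimately have "?g \<in> bcontfun"
    by (simp add: bcontfun_def)
  then show ?thesis
    by (simp add: as_functional_def Bcontfun_inverse discrete_inverse)
qed

text \<open>
  On \<open>prob_linf F\<close> the map \<open>as_functional F\<close> is injective if \<open>F\<close> contains the indicators of the points
  (as \<open>function_class C C' \<phi> e\<close> does for \<open>C \<ge> 1\<close>), so \<open>EROT\<close> is a function on the image.
\<close>

definition EROT_functional ::
    "real \<Rightarrow> ('x \<Rightarrow> 'y \<Rightarrow> real) \<Rightarrow> ('x \<Rightarrow> real) set \<Rightarrow> ('y \<Rightarrow> real) set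
      \<Rightarrow> 'x functional \<times> 'y functional \<Rightarrow> real" where
  "EROT_functional lam c FX FY = (\<lambda>(\<Phi>, \<Psi>).
     EROT lam c (inv_into (prob_linf FX) (as_functional FX) \<Phi>)
                (inv_into (prob_linf FY) (as_functional FY) \<Psi>))"

definition prob_domain ::
    "('x \<Rightarrow> real) set \<Rightarrow> ('y \<Rightarrow> real) set \<Rightarrow> ('x functional \<times> 'y functional) set" where
  "prob_domain FX FY = as_functional FX ` prob_linf FX \<times> as_functional FY ` prob_linf FY"

text \<open>
  The signed measure identified with a functional through its values on \<open>{f. \<bar>f\<bar> \<le> C}\<close>. For \<open>C \<ge> 1\<close>
  it is unique, since the indicators of points belong to this class; for elements of the contingent
  cone of the probability measures it exists, by completeness of \<open>ell1 C\<close>.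
\<close>

definition signed_measure :: "('a \<Rightarrow> real) \<Rightarrow> 'a functional \<Rightarrow> 'a \<Rightarrow> real" where
  "signed_measure C h = (THE a. a \<in> ell1 C \<and>
     (\<forall>f. (\<forall>z. \<bar>f z\<bar> \<le> C z) \<longrightarrow> apply_bcontfun h (discrete f) = pairing f a))"


subsection \<open>Hadamard differentiability\<close>

definition decreases_to_zero :: "(nat \<Rightarrow> real) \<Rightarrow> bool" where
  "decreases_to_zero t \<longleftrightarrow> decseq t \<and> (\<forall>n. 0 < t n) \<and> t \<longlonglongrightarrow> 0"

definition contingent_cone :: "'u::real_normed_vector \<Rightarrow> 'u set \<Rightarrow> 'u set" where
  "contingent_cone u U0 = {h. \<exists>t k. decreases_to_zero t \<and> (\<forall>n. k n \<in> U0) \<and>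
     (\<lambda>n. (k n - u) /\<^sub>R t n) \<longlonglongrightarrow> h}"

text \<open>
  The derivative \<open>D\<close> matters only on the contingent cone, where it has to be the restriction
  of a continuous linear map. The values of \<open>\<Psi>\<close> outside \<open>U0\<close> are irrelevant.
\<close>

definition has_hadamard_derivative ::
    "('u::real_normed_vector \<Rightarrow> 'v::real_normed_vector) \<Rightarrow> ('u \<Rightarrow> 'v) \<Rightarrow> 'u \<Rightarrow> 'u set \<Rightarrow> bool" where
  "has_hadamard_derivative \<Psi> D u U0 \<longleftrightarrow>
     u \<in> U0 \<and>
     (\<exists>L. bounded_linear L \<and> (\<forall>h\<in>contingent_cone u U0. D h = L h)) \<and>
     (\<forall>t k h. decreases_to_zero t \<and> (\<forall>n. k n \<in> U0) \<and> (\<lambda>n. (k n - u) /\<^sub>R t n) \<longlonglongrightarrow> h \<longrightarrow>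
        (\<lambda>n. norm ((\<Psi> (u + t n *\<^sub>R ((k n - u) /\<^sub>R t n)) - \<Psi> u) /\<^sub>R t n - D h)) \<longlonglongrightarrow> 0)"

end

theory Submission
  imports Defs "HOL-Library.Diagonal_Subsequence"
begin

text \<open>
  Potentials are the solutions \<open>(\<alpha>, \<beta>)\<close> of the Schrodinger system, which says that
  \<open>exp ((\<alpha> x + \<beta> y - c x y) / lam)\<close> is the density of a coupling with respect to the product of
  the marginals; they are normalized so that this holds at all points and not only on the supports.
  Duality and uniqueness both come from \<open>exp u \<ge> 1 + u\<close>, with equality only for \<open>u = 0\<close>.

  By Jensen's inequality and integrability of the exponential weights, normalized solutions are
  dominated by multiples of the weights that define the norms, uniformly for convergent marginals.
  Pointwise compactness then gives existence, as a limit of Sinkhorn iterates along which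
  both mean values \<open>\<langle>\<alpha>, r\<rangle>\<close> and \<open>\<langle>\<beta>, s\<rangle>\<close> increase, and, with uniqueness, pointwise stability.

  For the derivative the marginals are changed one at a time. Testing the dual problem with the
  potentials of the other pair gives
  \<open>\<langle>\<beta>\<^sub>1, s' - s\<rangle> \<le> EROT r s' - EROT r s \<le> \<langle>\<beta>\<^sub>2, s' - s\<rangle>\<close>
  for potentials of \<open>(r, s)\<close> and \<open>(r, s')\<close>, without a second-order term. After division by the
  step size both sides converge to \<open>\<langle>\<beta>, h\<rangle>\<close> by stability and domination.
\<close>

text \<open>The cost may be unbounded, so every bound on a potential has to be paid for by a moment
  of a marginal. Upper bounds are cheap: Jensen's inequality needs only means, so they hold in both
  collections of dominating functions. A lower bound needs an exponential moment, because an upper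
  bound on the other potential and a lower bound on \<open>c\<close> must dominate the integrand of
  an entropic transform. The lower bound of \<alpha> comes from the unprimed collection through
  \<open>phiY\<close>, that of \<beta> from the primed one through \<open>phiX'\<close>. Hence
  \<alpha> is measured by \<open>CX\<close> and \<beta> by \<open>CY'\<close>, and exchanging the
  two spaces exchanges the two collections.

  The second-order term that one-at-a-time changes avoid is the integral of the Gibbs density of
  \<open>(r, s)\<close> against the product of \<open>r' - r\<close> and \<open>s' - s\<close>,
  while the function classes test only functions of one variable.\<close>

subsection \<open>Integrals against probability mass functions\<close>

lemma integrable_count_space_iff_summable_on:
  fixes f :: "'a \<Rightarrow> real"
  shows "integrable (count_space A) f \<longleftrightarrow> f summable_on A"
proof -
  have "integrable (count_space A) f \<longleftrightarrow> Infinite_Set_Sum.abs_summable_on f A"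
    by (simp add: Infinite_Set_Sum.abs_summable_on_def)
  also have "\<dots> \<longleftrightarrow> f summable_on A"
    using abs_summable_equivalent[of f A] summable_on_iff_abs_summable_on_real[of f A] by simp
  finally show ?thesis .
qed

lemma integral_count_space_eq_infsum:
  fixes f :: "'a \<Rightarrow> real"
  shows "integral\<^sup>L (count_space A) f = infsum f A"
proof (cases "f summable_on A")
  case True
  then have "Infinite_Set_Sum.abs_summable_on f A"
    using abs_summable_equivalent[of f A] summable_on_iff_abs_summable_on_real[of f A] by simp
  then show ?thesis
    using infsetsum_infsum[of f A] by (simp add: infsetsum_def)
next
  case False
  then show ?thesis
    using integrable_count_space_iff_summable_on[of A f]
    by (simp add: infsum_not_exists not_integrable_integral_eq)
qed

lemma integrable_pmf_iff_count_space:
  fixes f :: "'a \<Rightarrow> real"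
  shows "integrable (measure_pmf r) f \<longleftrightarrow> integrable (count_space UNIV) (\<lambda>x. f x * pmf r x)"
  unfolding measure_pmf_eq_density by (subst integrable_density) (auto simp: mult.commute)

lemma integral_pmf_eq_count_space:
  fixes f :: "'a \<Rightarrow> real"
  shows "measure_pmf.expectation r f = integral\<^sup>L (count_space UNIV) (\<lambda>x. f x * pmf r x)"
  unfolding measure_pmf_eq_density by (subst integral_density) (auto simp: mult.commute)

lemma integrable_pmf_iff_summable_on:
  fixes f :: "'a \<Rightarrow> real"
  shows "integrable (measure_pmf r) f \<longleftrightarrow> (\<lambda>x. f x * pmf r x) summable_on UNIV"
  by (simp add: integrable_pmf_iff_count_space integrable_count_space_iff_summable_on)

lemma integral_pmf_eq_infsum:
  fixes f :: "'a \<Rightarrow> real"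
  shows "measure_pmf.expectation r f = (\<Sum>\<^sub>\<infinity>x. f x * pmf r x)"
  by (simp add: integral_pmf_eq_count_space integral_count_space_eq_infsum)

lemma mem_ell1_pmf: "f \<in> ell1 (pmf r) \<longleftrightarrow> integrable (measure_pmf r) f"
proof -
  have "integrable (measure_pmf r) f \<longleftrightarrow> integrable (measure_pmf r) (\<lambda>x. \<bar>f x\<bar>)"
    using integrable_norm_iff[of f "measure_pmf r"] by simp
  also have "\<dots> \<longleftrightarrow> f \<in> ell1 (pmf r)"
    unfolding ell1_def integrable_pmf_iff_summable_on by (simp add: mult.commute)
  finally show ?thesis by simp
qed

lemma pairing_pmf: "pairing f (pmf r) = measure_pmf.expectation r f"
  by (simp add: pairing_def integral_pmf_eq_infsum)

lemma integrable_pmf_bound: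
  fixes f g :: "'a \<Rightarrow> real"
  assumes "integrable (measure_pmf r) g" "\<And>x. \<bar>f x\<bar> \<le> g x"
  shows "integrable (measure_pmf r) f"
  by (rule Bochner_Integration.integrable_bound[OF assms(1)])
    (use assms(2) in \<open>auto intro: order_trans[OF _ abs_ge_self]\<close>)

lemma integrable_pair_pmf_fst:
  fixes f :: "'a \<Rightarrow> real"
  assumes "map_pmf fst p = r"
  shows "integrable (measure_pmf p) (\<lambda>z. f (fst z)) \<longleftrightarrow> integrable (measure_pmf r) f"
    and "measure_pmf.expectation p (\<lambda>z. f (fst z)) = measure_pmf.expectation r f"
  using assms by auto

lemma integrable_pair_pmf_snd:
  fixes f :: "'b \<Rightarrow> real"
  assumes "map_pmf snd p = s"
  shows "integrable (measure_pmf p) (\<lambda>z. f (snd z)) \<longleftrightarrow> integrable (measure_pmf s) f"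
    and "measure_pmf.expectation p (\<lambda>z. f (snd z)) = measure_pmf.expectation s f"
  using assms by auto

text \<open>Tonelli's theorem for a kernel whose normalization is known in one variable only, with
  integrability on the product as a conclusion. This is the situation in a Sinkhorn step and for
  potentials tested after one marginal has changed.\<close>

lemma pair_pmf_swap_integral:
  fixes f :: "'a \<Rightarrow> 'b \<Rightarrow> real"
  assumes nn: "\<And>x y. 0 \<le> f x y"
    and x: "\<And>y. integrable (measure_pmf r) (\<lambda>x. f x y)"
      "\<And>y. measure_pmf.expectation r (\<lambda>x. f x y) = 1"
    and y: "\<And>x. integrable (measure_pmf s) (f x)"
  shows "integrable (measure_pmf (pair_pmf r s)) (\<lambda>(x, y). f x y)"
    and "measure_pmf.expectation (pair_pmf r s) (\<lambda>(x, y). f x y) = 1"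
    and "integrable (measure_pmf r) (\<lambda>x. measure_pmf.expectation s (f x))"
    and "measure_pmf.expectation r (\<lambda>x. measure_pmf.expectation s (f x)) = 1"
proof -
  let ?g = "\<lambda>x. measure_pmf.expectation s (f x)"
  have "(\<integral>\<^sup>+z. ennreal (case z of (x, y) \<Rightarrow> f x y) \<partial>pair_pmf r s)
      = (\<integral>\<^sup>+z. ennreal (case z of (y, x) \<Rightarrow> f x y) \<partial>pair_pmf s r)"
    by (subst pair_commute_pmf) (simp add: nn_integral_map_pmf split_beta)
  also have "\<dots> = (\<integral>\<^sup>+y. \<integral>\<^sup>+x. ennreal (f x y) \<partial>r \<partial>s)"
    by (simp add: nn_integral_pair_pmf')
  also have "\<dots> = (\<integral>\<^sup>+y. 1 \<partial>s)"
    by (intro nn_integral_cong) (simp add: nn_integral_eq_integral x nn)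
  finally have *: "(\<integral>\<^sup>+z. ennreal (case z of (x, y) \<Rightarrow> f x y) \<partial>pair_pmf r s) = 1"
    by simp
  have nn': "\<And>z. 0 \<le> (case z of (x, y) \<Rightarrow> f x y)"
    using nn by auto
  show 1: "integrable (measure_pmf (pair_pmf r s)) (\<lambda>(x, y). f x y)"
    by (rule integrableI_nn_integral_finite[where x = 1]) (use * nn' in auto)
  show "measure_pmf.expectation (pair_pmf r s) (\<lambda>(x, y). f x y) = 1"
    using nn_integral_eq_integral[OF 1] * nn' by simp
  have "(\<integral>\<^sup>+x. ennreal (?g x) \<partial>r) = (\<integral>\<^sup>+x. \<integral>\<^sup>+y. ennreal (f x y) \<partial>s \<partial>r)"
    by (intro nn_integral_cong) (simp add: nn_integral_eq_integral y nn)
  also have "\<dots> = 1"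
    using * by (simp add: nn_integral_pair_pmf')
  finally have **: "(\<integral>\<^sup>+x. ennreal (?g x) \<partial>r) = 1" .
  have nng: "\<And>x. 0 \<le> ?g x"
    using nn by (simp add: integral_nonneg_AE)
  show 2: "integrable (measure_pmf r) ?g"
    by (rule integrableI_nn_integral_finite[where x = 1]) (use ** nng in auto)
  show "measure_pmf.expectation r ?g = 1"
    using nn_integral_eq_integral[OF 2] ** nng by simp
qed

lemma integral_pmf_pos:
  fixes f :: "'a \<Rightarrow> real"
  assumes "integrable (measure_pmf r) f" "\<And>x. 0 < f x"
  shows "0 < measure_pmf.expectation r f"
proof -
  have "measure_pmf.expectation r f \<noteq> 0"
  proof
    assume "measure_pmf.expectation r f = 0"
    then have "AE x in measure_pmf r. f x = 0"
      using integral_nonneg_eq_0_iff_AE[OF assms(1)] assms(2) by (simp add: less_imp_le)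
    then show False
      using assms(2) set_pmf_not_empty[of r] unfolding AE_measure_pmf_iff by (metis all_not_in_conv less_irrefl)
  qed
  moreover have "0 \<le> measure_pmf.expectation r f"
    using assms(2) by (intro integral_nonneg_AE) (simp add: less_imp_le)
  ultimately show ?thesis by simp
qed

text \<open>The tangent of \<open>exp\<close> at the mean lies below \<open>exp\<close> and
  integrates to \<open>exp\<close> of the mean.\<close>

lemma exp_jensen_pmf:
  fixes f :: "'a \<Rightarrow> real"
  assumes "integrable (measure_pmf r) f" "integrable (measure_pmf r) (\<lambda>x. exp (f x))"
  shows "exp (measure_pmf.expectation r f) \<le> measure_pmf.expectation r (\<lambda>x. exp (f x))"
proof -
  let ?m = "measure_pmf.expectation r f"
  have "exp ?m = measure_pmf.expectation r (\<lambda>x. exp ?m * (1 + (f x - ?m)))"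
    using assms(1) by simp
  also have "\<dots> \<le> measure_pmf.expectation r (\<lambda>x. exp (f x))"
  proof (rule integral_mono)
    fix x
    have "exp ?m * (1 + (f x - ?m)) \<le> exp ?m * exp (f x - ?m)"
      by (intro mult_left_mono exp_ge_add_one_self) auto
    also have "\<dots> = exp (f x)"
      by (simp flip: exp_add)
    finally show "exp ?m * (1 + (f x - ?m)) \<le> exp (f x)" .
  qed (use assms in auto)
  finally show ?thesis .
qed

section \<open>Varying integrands against convergent mass functions\<close>

definition pmf_conv :: "('a \<Rightarrow> real) \<Rightarrow> (nat \<Rightarrow> 'a pmf) \<Rightarrow> 'a pmf \<Rightarrow> bool" where
  "pmf_conv w R r \<longleftrightarrow> (\<forall>x. (\<lambda>n. pmf (R n) x) \<longlonglongrightarrow> pmf r x) \<and>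
     integrable (measure_pmf r) w \<and> (\<forall>n. integrable (measure_pmf (R n)) w) \<and>
     (\<lambda>n. measure_pmf.expectation (R n) w) \<longlonglongrightarrow> measure_pmf.expectation r w"

lemma pmf_conv_const: "integrable (measure_pmf r) w \<Longrightarrow> pmf_conv w (\<lambda>_. r) r"
  by (simp add: pmf_conv_def)

lemma pmf_conv_subseq: "pmf_conv w R r \<Longrightarrow> strict_mono k \<Longrightarrow> pmf_conv w (R \<circ> k) r"
  using LIMSEQ_subseq_LIMSEQ[of _ _ k] unfolding pmf_conv_def o_def by blast

text \<open>Scheffe's lemma upgrades convergence of the point masses and of the
  \<open>w\<close>-means to convergence in the \<open>ell1\<close> norm weighted by
  \<open>w\<close>. Changing the measure then costs at most \<open>K\<close> times that distance,
  uniformly in the integrand; changing the integrand under the fixed \<open>r\<close> is dominated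
  convergence.\<close>

lemma pmf_conv_integral:
  fixes w f :: "'a::countable \<Rightarrow> real"
  assumes conv: "pmf_conv w R r" and nn: "\<And>x. 0 \<le> w x"
    and bd: "\<And>n x. \<bar>f' n x\<bar> \<le> K * w x" and f: "\<And>x. (\<lambda>n. f' n x) \<longlonglongrightarrow> f x"
  shows "(\<lambda>n. measure_pmf.expectation (R n) (f' n)) \<longlonglongrightarrow> measure_pmf.expectation r f"
    and "integrable (measure_pmf r) f" and "\<And>n. integrable (measure_pmf (R n)) (f' n)"
proof -
  let ?M = "count_space (UNIV :: 'a set)"
  define F where "F = (\<lambda>n x. w x * pmf (R n) x)"
  define G where "G = (\<lambda>x. w x * pmf r x)"
  have pw: "\<And>x. (\<lambda>n. pmf (R n) x) \<longlonglongrightarrow> pmf r x" and iw: "integrable (measure_pmf r) w"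
    and iwn: "\<And>n. integrable (measure_pmf (R n)) w"
    and cw: "(\<lambda>n. measure_pmf.expectation (R n) w) \<longlonglongrightarrow> measure_pmf.expectation r w"
    using conv by (auto simp: pmf_conv_def)
  have F: "integrable ?M (F n)" "0 \<le> F n x" for n x
    using iwn nn by (auto simp: F_def integrable_pmf_iff_count_space)
  have G: "integrable ?M G" "0 \<le> G x" for x
    using iw nn by (auto simp: G_def integrable_pmf_iff_count_space)
  have nnF: "(\<integral>\<^sup>+x. norm (F n x) \<partial>?M) = ennreal (measure_pmf.expectation (R n) w)" for n
    using nn_integral_eq_integral[OF F(1), of n] F(2)
    by (simp add: integral_pmf_eq_count_space F_def)
  have nnG: "(\<integral>\<^sup>+x. norm (G x) \<partial>?M) = ennreal (measure_pmf.expectation r w)"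
    using nn_integral_eq_integral[OF G(1)] G(2)
    by (simp add: integral_pmf_eq_count_space G_def)
  have "(\<lambda>n. \<integral>\<^sup>+x. norm (F n x) \<partial>?M) \<longlonglongrightarrow> (\<integral>\<^sup>+x. norm (G x) \<partial>?M)"
    unfolding nnF nnG using cw by (rule tendsto_ennrealI)
  then have "limsup (\<lambda>n. \<integral>\<^sup>+x. norm (F n x) \<partial>?M) \<le> (\<integral>\<^sup>+x. norm (G x) \<partial>?M)"
    by (simp add: lim_imp_Limsup)
  then have lim0: "(\<lambda>n. \<integral>\<^sup>+x. norm (F n x - G x) \<partial>?M) \<longlonglongrightarrow> 0"
    using F(1) G(1) pw by (intro Scheffe_lemma1) (auto simp: F_def G_def intro!: tendsto_intros)
  have intd: "integrable ?M (\<lambda>x. norm (F n x - G x))" for n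
    using F(1) G(1) by auto
  have "(\<lambda>n. ennreal (\<integral>x. norm (F n x - G x) \<partial>?M)) \<longlonglongrightarrow> ennreal 0"
    using lim0 nn_integral_eq_integral[OF intd] by simp
  then have lim: "(\<lambda>n. \<integral>x. norm (F n x - G x) \<partial>?M) \<longlonglongrightarrow> 0"
    by (subst (asm) tendsto_ennreal_iff) auto
  have bf: "\<bar>f x\<bar> \<le> K * w x" for x
    by (rule LIMSEQ_le_const2[OF tendsto_rabs[OF f[of x]]]) (use bd in auto)
  show int: "integrable (measure_pmf r) f"
    by (rule integrable_pmf_bound[where g = "\<lambda>x. K * w x"]) (use iw bf in auto)
  show intn: "integrable (measure_pmf (R n)) (f' n)" for n
    by (rule integrable_pmf_bound[where g = "\<lambda>x. K * w x"]) (use iwn bd in auto)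
  have intr: "integrable (measure_pmf r) (f' n)" for n
    by (rule integrable_pmf_bound[where g = "\<lambda>x. K * w x"]) (use iw bd in auto)
  have c1: "(\<lambda>n. measure_pmf.expectation r (f' n)) \<longlonglongrightarrow> measure_pmf.expectation r f"
    by (rule integral_dominated_convergence[where w = "\<lambda>x. K * w x"]) (use iw bd f in auto)
  have c2: "(\<lambda>n. measure_pmf.expectation (R n) (f' n) - measure_pmf.expectation r (f' n)) \<longlonglongrightarrow> 0"
  proof (rule Lim_null_comparison)
    show "(\<lambda>n. K * (\<integral>x. norm (F n x - G x) \<partial>?M)) \<longlonglongrightarrow> 0"
      using tendsto_mult_right_zero[OF lim] by simp
    show "\<forall>\<^sub>F n in sequentially. norm (measure_pmf.expectation (R n) (f' n) - measure_pmf.expectation r (f' n))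
        \<le> K * (\<integral>x. norm (F n x - G x) \<partial>?M)"
    proof (intro always_eventually allI)
      fix n
      have "measure_pmf.expectation (R n) (f' n) - measure_pmf.expectation r (f' n)
          = (\<integral>x. f' n x * pmf (R n) x - f' n x * pmf r x \<partial>?M)"
        unfolding integral_pmf_eq_count_space
        by (rule Bochner_Integration.integral_diff[symmetric])
          (use intn intr in \<open>auto simp: integrable_pmf_iff_count_space\<close>)
      also have "norm \<dots> \<le> (\<integral>x. K * norm (F n x - G x) \<partial>?M)"
      proof (rule order_trans[OF integral_norm_bound integral_mono])
        fix x
        have "norm (f' n x * pmf (R n) x - f' n x * pmf r x) = \<bar>f' n x\<bar> * \<bar>pmf (R n) x - pmf r x\<bar>"
          by (simp add: right_diff_distrib[symmetric] abs_mult)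
        also have "\<dots> \<le> K * w x * \<bar>pmf (R n) x - pmf r x\<bar>"
          using bd by (intro mult_right_mono) auto
        also have "\<dots> = K * norm (F n x - G x)"
          using nn[of x] by (simp add: F_def G_def right_diff_distrib[symmetric] abs_mult)
        finally show "norm (f' n x * pmf (R n) x - f' n x * pmf r x) \<le> K * norm (F n x - G x)" .
      qed (use intn intr intd in \<open>auto simp: integrable_pmf_iff_count_space\<close>)
      finally show "norm (measure_pmf.expectation (R n) (f' n) - measure_pmf.expectation r (f' n))
        \<le> K * (\<integral>x. norm (F n x - G x) \<partial>?M)"
        by simp
    qed
  qed
  show "(\<lambda>n. measure_pmf.expectation (R n) (f' n)) \<longlonglongrightarrow> measure_pmf.expectation r f"
    using tendsto_add[OF c2 c1] by simp
qed

subsection \<open>The Schrodinger system and duality\<close>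

definition gibbs :: "real \<Rightarrow> ('x \<Rightarrow> 'y \<Rightarrow> real) \<Rightarrow> ('x \<Rightarrow> real) \<Rightarrow> ('y \<Rightarrow> real) \<Rightarrow> 'x \<Rightarrow> 'y \<Rightarrow> real" where
  "gibbs lam c \<alpha> \<beta> x y = exp ((\<alpha> x + \<beta> y - c x y) / lam)"

definition schrodinger ::
    "real \<Rightarrow> ('x \<Rightarrow> 'y \<Rightarrow> real) \<Rightarrow> 'x pmf \<Rightarrow> 'y pmf \<Rightarrow> ('x \<Rightarrow> real) \<Rightarrow> ('y \<Rightarrow> real) \<Rightarrow> bool" where
  "schrodinger lam c r s \<alpha> \<beta> \<longleftrightarrow>
     integrable (measure_pmf r) \<alpha> \<and> integrable (measure_pmf s) \<beta> \<and>
     (\<forall>x. integrable (measure_pmf s) (\<lambda>y. gibbs lam c \<alpha> \<beta> x y) \<and>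
          measure_pmf.expectation s (\<lambda>y. gibbs lam c \<alpha> \<beta> x y) = 1) \<and>
     (\<forall>y. integrable (measure_pmf r) (\<lambda>x. gibbs lam c \<alpha> \<beta> x y) \<and>
          measure_pmf.expectation r (\<lambda>x. gibbs lam c \<alpha> \<beta> x y) = 1)"

lemma gibbs_pos: "0 < gibbs lam c \<alpha> \<beta> x y"
  by (simp add: gibbs_def)

lemma gibbs_nonneg: "0 \<le> gibbs lam c \<alpha> \<beta> x y"
  by (simp add: gibbs_def)

lemma schrodingerD:
  assumes "schrodinger lam c r s \<alpha> \<beta>"
  shows "integrable (measure_pmf r) \<alpha>" "integrable (measure_pmf s) \<beta>"
    and "integrable (measure_pmf s) (\<lambda>y. gibbs lam c \<alpha> \<beta> x y)"
    and "measure_pmf.expectation s (\<lambda>y. gibbs lam c \<alpha> \<beta> x y) = 1"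
    and "integrable (measure_pmf r) (\<lambda>x. gibbs lam c \<alpha> \<beta> x y)"
    and "measure_pmf.expectation r (\<lambda>x. gibbs lam c \<alpha> \<beta> x y) = 1"
  using assms by (auto simp: schrodinger_def)

lemma schrodinger_swap:
  assumes "schrodinger lam c r s \<alpha> \<beta>"
  shows "schrodinger lam (\<lambda>y x. c x y) s r \<beta> \<alpha>"
  using assms by (simp add: schrodinger_def gibbs_def add.commute)

lemma schrodinger_shift:
  assumes "schrodinger lam c r s \<alpha> \<beta>"
  shows "schrodinger lam c r s (\<lambda>x. \<alpha> x + \<eta>) (\<lambda>y. \<beta> y - \<eta>)"
  using assms by (simp add: schrodinger_def gibbs_def)

lemma gibbs_pair_integral:
  assumes "schrodinger lam c r s \<alpha> \<beta>"
  shows "integrable (measure_pmf (pair_pmf r s)) (\<lambda>(x, y). gibbs lam c \<alpha> \<beta> x y)"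
    and "measure_pmf.expectation (pair_pmf r s) (\<lambda>(x, y). gibbs lam c \<alpha> \<beta> x y) = 1"
  using pair_pmf_swap_integral[of "gibbs lam c \<alpha> \<beta>" r s] schrodingerD[OF assms] gibbs_nonneg
  by metis+

section \<open>The coupling with Gibbs density\<close>

definition opt_coupling ::
    "real \<Rightarrow> ('x \<Rightarrow> 'y \<Rightarrow> real) \<Rightarrow> 'x pmf \<Rightarrow> 'y pmf \<Rightarrow> ('x \<Rightarrow> real) \<Rightarrow> ('y \<Rightarrow> real) \<Rightarrow> ('x \<times> 'y) pmf" where
  "opt_coupling lam c r s \<alpha> \<beta> =
     embed_pmf (\<lambda>z. gibbs lam c \<alpha> \<beta> (fst z) (snd z) * pmf (pair_pmf r s) z)"

lemma pmf_opt_coupling: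
  assumes "schrodinger lam c r s \<alpha> \<beta>"
  shows "pmf (opt_coupling lam c r s \<alpha> \<beta>) z = gibbs lam c \<alpha> \<beta> (fst z) (snd z) * pmf (pair_pmf r s) z"
  unfolding opt_coupling_def
proof (rule pmf_embed_pmf)
  let ?f = "\<lambda>z. gibbs lam c \<alpha> \<beta> (fst z) (snd z) * pmf (pair_pmf r s) z"
  show nn: "0 \<le> ?f z" for z
    by (simp add: gibbs_nonneg)
  have "integrable (count_space UNIV) ?f" "integral\<^sup>L (count_space UNIV) ?f = 1"
    using gibbs_pair_integral[OF assms]
    by (simp_all add: integrable_pmf_iff_count_space integral_pmf_eq_count_space split_beta)
  then show "(\<integral>\<^sup>+z. ennreal (?f z) \<partial>count_space UNIV) = 1"
    using nn by (simp add: nn_integral_eq_integral)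
qed

lemma opt_coupling_integral:
  fixes h :: "'x \<times> 'y \<Rightarrow> real"
  assumes "schrodinger lam c r s \<alpha> \<beta>"
  shows "integrable (measure_pmf (opt_coupling lam c r s \<alpha> \<beta>)) h \<longleftrightarrow>
      integrable (measure_pmf (pair_pmf r s)) (\<lambda>z. h z * gibbs lam c \<alpha> \<beta> (fst z) (snd z))"
    and "measure_pmf.expectation (opt_coupling lam c r s \<alpha> \<beta>) h =
      measure_pmf.expectation (pair_pmf r s) (\<lambda>z. h z * gibbs lam c \<alpha> \<beta> (fst z) (snd z))"
  by (simp_all add: integrable_pmf_iff_count_space integral_pmf_eq_count_space
      pmf_opt_coupling[OF assms] mult.assoc)

lemma pmf_map_fst: "pmf (map_pmf fst p) x = (\<Sum>\<^sub>\<infinity>y. pmf p (x, y))"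
proof -
  have "fst -` {x} = range (Pair x)"
    by auto
  then have "pmf (map_pmf fst p) x = measure p (range (Pair x))"
    by (subst pmf_map) (rule arg_cong)
  also have "\<dots> = (\<integral>z. pmf p z \<partial>count_space (range (Pair x)))"
    by (simp add: integral_pmf)
  also have "\<dots> = (\<Sum>\<^sub>\<infinity>z\<in>range (Pair x). pmf p z)"
    by (simp add: integral_count_space_eq_infsum)
  also have "\<dots> = (\<Sum>\<^sub>\<infinity>y. pmf p (x, y))"
    by (subst infsum_reindex) (auto simp: inj_on_def o_def)
  finally show ?thesis .
qed

lemma map_fst_opt_coupling:
  assumes "schrodinger lam c r s \<alpha> \<beta>"
  shows "map_pmf fst (opt_coupling lam c r s \<alpha> \<beta>) = r"
proof (rule pmf_eqI)
  fix x
  have "pmf (map_pmf fst (opt_coupling lam c r s \<alpha> \<beta>)) x =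
      (\<Sum>\<^sub>\<infinity>y. pmf r x * (gibbs lam c \<alpha> \<beta> x y * pmf s y))"
    by (simp add: pmf_map_fst pmf_opt_coupling[OF assms] pmf_pair mult.left_commute)
  also have "\<dots> = pmf r x * measure_pmf.expectation s (\<lambda>y. gibbs lam c \<alpha> \<beta> x y)"
    by (simp add: infsum_cmult_right' integral_pmf_eq_infsum)
  finally show "pmf (map_pmf fst (opt_coupling lam c r s \<alpha> \<beta>)) x = pmf r x"
    using schrodingerD(4)[OF assms] by simp
qed

lemma opt_coupling_swap:
  assumes "schrodinger lam c r s \<alpha> \<beta>"
  shows "opt_coupling lam (\<lambda>y x. c x y) s r \<beta> \<alpha> = map_pmf prod.swap (opt_coupling lam c r s \<alpha> \<beta>)"
proof (rule pmf_eqI)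
  fix z
  have "pmf (map_pmf prod.swap (opt_coupling lam c r s \<alpha> \<beta>)) z = pmf (opt_coupling lam c r s \<alpha> \<beta>) (prod.swap z)"
    using pmf_map_inj'[of prod.swap "opt_coupling lam c r s \<alpha> \<beta>" "prod.swap z"]
    by (simp add: inj_on_def prod.swap_def)
  also have "\<dots> = pmf (opt_coupling lam (\<lambda>y x. c x y) s r \<beta> \<alpha>) z"
    unfolding pmf_opt_coupling[OF assms] pmf_opt_coupling[OF schrodinger_swap[OF assms]]
    by (cases z) (simp add: pmf_pair gibbs_def add.commute)
  finally show "pmf (opt_coupling lam (\<lambda>y x. c x y) s r \<beta> \<alpha>) z =
      pmf (map_pmf prod.swap (opt_coupling lam c r s \<alpha> \<beta>)) z" by simp
qed

lemma map_snd_opt_coupling: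
  assumes "schrodinger lam c r s \<alpha> \<beta>"
  shows "map_pmf snd (opt_coupling lam c r s \<alpha> \<beta>) = s"
proof -
  have "map_pmf snd (opt_coupling lam c r s \<alpha> \<beta>) = map_pmf fst (map_pmf prod.swap (opt_coupling lam c r s \<alpha> \<beta>))"
    by (simp add: pmf.map_comp o_def)
  also have "\<dots> = s"
    using map_fst_opt_coupling[OF schrodinger_swap[OF assms]] opt_coupling_swap[OF assms] by simp
  finally show ?thesis .
qed

text \<open>Points of \<open>p\<close>-mass zero contribute nothing on either side, so the
  information is a mean under \<open>p\<close> of a log density. This form admits almost-everywhere
  arguments under \<open>p\<close>.\<close>

lemma mutual_info_eq:
  "mutual_info r s p =
    (let l = (\<lambda>z. ln (pmf p z / pmf (pair_pmf r s) z))
     in if integrable (measure_pmf p) l then ereal (measure_pmf.expectation p l) else \<infinity>)"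
proof -
  have *: "(\<lambda>(x, y). pmf p (x, y) * ln (pmf p (x, y) / (pmf r x * pmf s y)))
    = (\<lambda>z. ln (pmf p z / pmf (pair_pmf r s) z) * pmf p z)"
    by (auto simp: pmf_pair mult.commute)
  show ?thesis
    unfolding mutual_info_def * Let_def
    by (simp add: integrable_pmf_iff_summable_on integral_pmf_eq_infsum)
qed

lemma dual_objective_eq:
  "dual_objective lam c r s \<alpha> \<beta> =
    (let g = (\<lambda>(x, y). gibbs lam c \<alpha> \<beta> x y)
     in if integrable (measure_pmf (pair_pmf r s)) g
        then ereal (measure_pmf.expectation r \<alpha> + measure_pmf.expectation s \<beta>
          - lam * (measure_pmf.expectation (pair_pmf r s) g - 1))
        else - \<infinity>)"
proof -
  let ?g = "\<lambda>(x, y). gibbs lam c \<alpha> \<beta> x y"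
  have *: "(\<lambda>(x, y). exp ((\<alpha> x + \<beta> y - c x y) / lam) * (pmf r x * pmf s y) - pmf r x * pmf s y)
    = (\<lambda>z. (?g z - 1) * pmf (pair_pmf r s) z)"
    by (auto simp: gibbs_def pmf_pair algebra_simps)
  have i: "integrable (measure_pmf (pair_pmf r s)) (\<lambda>z. ?g z - 1) \<longleftrightarrow>
      integrable (measure_pmf (pair_pmf r s)) ?g"
  proof
    assume "integrable (measure_pmf (pair_pmf r s)) (\<lambda>z. ?g z - 1)"
    then have "integrable (measure_pmf (pair_pmf r s)) (\<lambda>z. (?g z - 1) + 1)"
      by (intro Bochner_Integration.integrable_add) auto
    then show "integrable (measure_pmf (pair_pmf r s)) ?g"
      by simp
  qed auto
  show ?thesis
    unfolding dual_objective_def * Let_def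
    unfolding integrable_pmf_iff_summable_on[symmetric] integral_pmf_eq_infsum[symmetric] i pairing_pmf
    by simp
qed

lemma exp_eq_add_one_iff: "exp u = 1 + u \<longleftrightarrow> u = 0" for u :: real
proof
  assume eq: "exp u = 1 + u"
  \<comment> \<open>Since \<open>1 + u\<close> equals an exponential, \<open>u > -1\<close>. So both
    sides of \<open>1 + u / 2 \<le> exp (u / 2)\<close> may be squared, and
    \<open>u\<^sup>2 / 4 \<le> 0\<close> remains.\<close>
  then have "0 \<le> 1 + u / 2"
    using exp_gt_zero[of u] by simp
  then have "(1 + u / 2)\<^sup>2 \<le> (exp (u / 2))\<^sup>2"
    by (intro power_mono exp_ge_add_one_self)
  also have "\<dots> = 1 + u"
    using eq by (simp flip: exp_double)
  finally have "u\<^sup>2 \<le> 0"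
    by (simp add: power2_eq_square field_simps)
  then show "u = 0"
    by simp
qed simp

text \<open>Relative to the coupling \<open>?p\<close> built from the solution, the kernel of the
  competitor has density \<open>exp u\<close>, where \<open>lam * u\<close> is the change of the sum
  of the potentials. So \<open>G - 1\<close> is at least the \<open>?p\<close>-mean of
  \<open>u\<close>, which depends on the marginals only. In the case of equality \<open>u\<close>
  vanishes on the support of \<open>?p\<close>, which is the full product of the supports because
  Gibbs densities are positive.\<close>

lemma dual_gap:
  assumes lam: "lam > 0" and sol: "schrodinger lam c r s \<alpha> \<beta>"
    and a: "integrable (measure_pmf r) \<alpha>'" and b: "integrable (measure_pmf s) \<beta>'"
    and g: "integrable (measure_pmf (pair_pmf r s)) (\<lambda>(x, y). gibbs lam c \<alpha>' \<beta>' x y)"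
  defines "G \<equiv> measure_pmf.expectation (pair_pmf r s) (\<lambda>(x, y). gibbs lam c \<alpha>' \<beta>' x y)"
  shows "measure_pmf.expectation r \<alpha>' + measure_pmf.expectation s \<beta>' - lam * (G - 1)
      \<le> measure_pmf.expectation r \<alpha> + measure_pmf.expectation s \<beta>"
    and "measure_pmf.expectation r \<alpha>' + measure_pmf.expectation s \<beta>' - lam * (G - 1)
      = measure_pmf.expectation r \<alpha> + measure_pmf.expectation s \<beta> \<Longrightarrow>
      x \<in> set_pmf r \<Longrightarrow> y \<in> set_pmf s \<Longrightarrow> \<alpha>' x - \<alpha> x + (\<beta>' y - \<beta> y) = 0"
proof -
  let ?p = "opt_coupling lam c r s \<alpha> \<beta>"
  define u where "u = (\<lambda>z. (\<alpha>' (fst z) - \<alpha> (fst z) + (\<beta>' (snd z) - \<beta> (snd z))) / lam)"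
  note fst' = integrable_pair_pmf_fst[OF map_fst_opt_coupling[OF sol]]
  note snd' = integrable_pair_pmf_snd[OF map_snd_opt_coupling[OF sol]]
  have ia: "integrable (measure_pmf r) (\<lambda>x. \<alpha>' x - \<alpha> x)" and ib: "integrable (measure_pmf s) (\<lambda>y. \<beta>' y - \<beta> y)"
    using a b schrodingerD(1,2)[OF sol] by auto
  have ia': "integrable (measure_pmf ?p) (\<lambda>z. \<alpha>' (fst z) - \<alpha> (fst z))"
    and ib': "integrable (measure_pmf ?p) (\<lambda>z. \<beta>' (snd z) - \<beta> (snd z))"
    using ia ib fst'(1)[of "\<lambda>x. \<alpha>' x - \<alpha> x"] snd'(1)[of "\<lambda>y. \<beta>' y - \<beta> y"] by simp_all
  have iu: "integrable (measure_pmf ?p) u"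
    unfolding u_def using ia' ib' by (intro integrable_divide Bochner_Integration.integrable_add)
  have eu: "lam * measure_pmf.expectation ?p u =
      measure_pmf.expectation r \<alpha>' - measure_pmf.expectation r \<alpha>
      + (measure_pmf.expectation s \<beta>' - measure_pmf.expectation s \<beta>)"
  proof -
    have "lam * measure_pmf.expectation ?p u = measure_pmf.expectation ?p
        (\<lambda>z. (\<alpha>' (fst z) - \<alpha> (fst z)) + (\<beta>' (snd z) - \<beta> (snd z)))"
      unfolding integral_mult_right_zero[symmetric] using lam by (simp add: u_def)
    also have "\<dots> = measure_pmf.expectation r (\<lambda>x. \<alpha>' x - \<alpha> x) + measure_pmf.expectation s (\<lambda>y. \<beta>' y - \<beta> y)"
      using fst'(2)[of "\<lambda>x. \<alpha>' x - \<alpha> x"] snd'(2)[of "\<lambda>y. \<beta>' y - \<beta> y"]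
      by (subst Bochner_Integration.integral_add[OF ia' ib']) simp
    finally show ?thesis
      using a b schrodingerD(1,2)[OF sol] by simp
  qed
  have gu: "exp (u z) * gibbs lam c \<alpha> \<beta> (fst z) (snd z) = (case z of (x, y) \<Rightarrow> gibbs lam c \<alpha>' \<beta>' x y)" for z
    by (simp add: gibbs_def u_def split_beta add_divide_distrib diff_divide_distrib flip: exp_add)
  have ie: "integrable (measure_pmf ?p) (\<lambda>z. exp (u z))" and ee: "measure_pmf.expectation ?p (\<lambda>z. exp (u z)) = G"
    unfolding opt_coupling_integral[OF sol] gu using g by (simp_all add: G_def)
  have iall: "integrable (measure_pmf ?p) (\<lambda>z. exp (u z) - (1 + u z))"
    using ie iu by auto
  have nn: "0 \<le> exp (u z) - (1 + u z)" for z
    using exp_ge_add_one_self[of "u z"] by simp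
  have e: "measure_pmf.expectation ?p (\<lambda>z. exp (u z) - (1 + u z)) = G - (1 + measure_pmf.expectation ?p u)"
    using ie iu by (simp add: ee)
  have "0 \<le> measure_pmf.expectation ?p (\<lambda>z. exp (u z) - (1 + u z))"
    using nn by (intro integral_nonneg_AE) simp
  then have "0 \<le> lam * (G - (1 + measure_pmf.expectation ?p u))"
    using lam e by simp
  then show "measure_pmf.expectation r \<alpha>' + measure_pmf.expectation s \<beta>' - lam * (G - 1)
      \<le> measure_pmf.expectation r \<alpha> + measure_pmf.expectation s \<beta>"
    using eu by (simp add: algebra_simps)
  assume eq: "measure_pmf.expectation r \<alpha>' + measure_pmf.expectation s \<beta>' - lam * (G - 1)
      = measure_pmf.expectation r \<alpha> + measure_pmf.expectation s \<beta>" and xy: "x \<in> set_pmf r" "y \<in> set_pmf s"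
  have "lam * (G - (1 + measure_pmf.expectation ?p u)) = 0"
    using eq eu by (simp add: algebra_simps)
  then have "measure_pmf.expectation ?p (\<lambda>z. exp (u z) - (1 + u z)) = 0"
    using lam e by simp
  then have "AE z in measure_pmf ?p. exp (u z) - (1 + u z) = 0"
    using integral_nonneg_eq_0_iff_AE[OF iall] nn by simp
  moreover have "(x, y) \<in> set_pmf ?p"
    using xy gibbs_pos[of lam c \<alpha> \<beta> x y] by (auto simp: set_pmf_iff pmf_opt_coupling[OF sol] pmf_pair)
  ultimately have "exp (u (x, y)) = 1 + u (x, y)"
    by (auto simp: AE_measure_pmf_iff)
  then show "\<alpha>' x - \<alpha> x + (\<beta>' y - \<beta> y) = 0"
    using lam by (simp add: exp_eq_add_one_iff u_def)
qed

text \<open>Let \<open>l\<close> be the log density of a coupling and \<open>v\<close> that of the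
  Gibbs coupling, both relative to the product. The inequality
  \<open>1 + (v - l) \<le> exp (v - l)\<close>, weighted with the coupling, gives the lower bound
  point by point; the Gibbs coupling has \<open>l = v\<close> and attains it. The bound on
  \<open>c\<close> makes the cost integrable under every coupling.\<close>

lemma EROT_schrodinger:
  assumes lam: "lam > 0" and sol: "schrodinger lam c r s \<alpha> \<beta>"
    and f: "integrable (measure_pmf r) f" and g: "integrable (measure_pmf s) g"
    and c: "\<And>x y. \<bar>c x y\<bar> \<le> f x + g y"
  shows "EROT lam c r s = measure_pmf.expectation r \<alpha> + measure_pmf.expectation s \<beta>"
proof -
  let ?V = "measure_pmf.expectation r \<alpha> + measure_pmf.expectation s \<beta>"
  let ?J = "\<lambda>p. ereal (pairing (\<lambda>(x, y). c x y) (pmf p)) + ereal lam * mutual_info r s p"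
  let ?p = "opt_coupling lam c r s \<alpha> \<beta>"
  have marg: "integrable (measure_pmf p) (\<lambda>(x, y). c x y)"
      "integrable (measure_pmf p) (\<lambda>z. \<alpha> (fst z) + \<beta> (snd z))"
      "measure_pmf.expectation p (\<lambda>z. \<alpha> (fst z) + \<beta> (snd z)) = ?V"
    if "p \<in> couplings r s" for p
  proof -
    have p: "map_pmf fst p = r" "map_pmf snd p = s"
      using that by (auto simp: couplings_def)
    note F = integrable_pair_pmf_fst[OF p(1)] and S = integrable_pair_pmf_snd[OF p(2)]
    have i: "integrable (measure_pmf p) (\<lambda>z. \<alpha> (fst z))" "integrable (measure_pmf p) (\<lambda>z. \<beta> (snd z))"
      "integrable (measure_pmf p) (\<lambda>z. f (fst z))" "integrable (measure_pmf p) (\<lambda>z. g (snd z))"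
      using F(1) S(1) schrodingerD(1,2)[OF sol] f g by blast+
    show "integrable (measure_pmf p) (\<lambda>(x, y). c x y)"
      by (rule integrable_pmf_bound[OF Bochner_Integration.integrable_add[OF i(3,4)]]) (use c in auto)
    show "integrable (measure_pmf p) (\<lambda>z. \<alpha> (fst z) + \<beta> (snd z))"
      using i by simp
    show "measure_pmf.expectation p (\<lambda>z. \<alpha> (fst z) + \<beta> (snd z)) = ?V"
      using i F(2)[of \<alpha>] S(2)[of \<beta>] by (subst Bochner_Integration.integral_add) auto
  qed
  have lower: "ereal ?V \<le> ?J p" if p: "p \<in> couplings r s" for p
  proof (cases "integrable (measure_pmf p) (\<lambda>z. ln (pmf p z / pmf (pair_pmf r s) z))")
    case False
    then show ?thesis
      using lam by (simp add: mutual_info_eq Let_def)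
  next
    case True
    let ?l = "\<lambda>z. ln (pmf p z / pmf (pair_pmf r s) z)"
    let ?C = "\<lambda>(x, y). c x y"
    have supp: "pmf (pair_pmf r s) z > 0" if "z \<in> set_pmf p" for z
    proof -
      have "fst z \<in> set_pmf r" "snd z \<in> set_pmf s"
        using p that by (auto simp: couplings_def)
      then show ?thesis
        by (cases z) (simp add: pmf_pair pmf_positive)
    qed
    have i1: "integrable (measure_pmf p) (\<lambda>z. ?C z + lam * ?l z)"
      using marg(1)[OF p] True by auto
    have i2: "integrable (count_space UNIV) (\<lambda>z. (\<alpha> (fst z) + \<beta> (snd z)) * pmf p z)"
      using marg(2)[OF p] by (simp add: integrable_pmf_iff_count_space)
    have i3: "integrable (count_space UNIV) (\<lambda>z. lam * (pmf p z - pmf ?p z))"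
      by (simp add: integrable_pmf)
    \<comment> \<open>Both mass functions sum to one, so the added multiple of
      \<open>pmf p z - pmf ?p z\<close> has integral zero; with it the inequality holds
      pointwise.\<close>
    have "?V = (\<integral>z. (\<alpha> (fst z) + \<beta> (snd z)) * pmf p z + lam * (pmf p z - pmf ?p z) \<partial>count_space UNIV)"
      using i2 i3 marg(3)[OF p]
      by (simp add: integral_pmf_eq_count_space integrable_pmf integral_pmf)
    also have "\<dots> \<le> (\<integral>z. (?C z + lam * ?l z) * pmf p z \<partial>count_space UNIV)"
    proof (rule integral_mono)
      show "integrable (count_space UNIV) (\<lambda>z. (?C z + lam * ?l z) * pmf p z)"
        using i1 by (simp add: integrable_pmf_iff_count_space)
      show "integrable (count_space UNIV)
          (\<lambda>z. (\<alpha> (fst z) + \<beta> (snd z)) * pmf p z + lam * (pmf p z - pmf ?p z))"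
        using i2 i3 by simp
      fix z
      show "(\<alpha> (fst z) + \<beta> (snd z)) * pmf p z + lam * (pmf p z - pmf ?p z) \<le> (?C z + lam * ?l z) * pmf p z"
      proof (cases "pmf p z = 0")
        case True
        then show ?thesis using lam by simp
      next
        case False
        then have pz: "pmf p z > 0" by (simp add: pmf_nonneg less_le)
        have q: "pmf (pair_pmf r s) z > 0"
          using supp False by (simp add: set_pmf_iff)
        define v where "v = (\<alpha> (fst z) + \<beta> (snd z) - ?C z) / lam"
        have pq: "pmf ?p z = exp v * pmf (pair_pmf r s) z"
          by (simp add: pmf_opt_coupling[OF sol] gibbs_def v_def split_beta)
        have "1 + (v - ?l z) \<le> exp (v - ?l z)"
          by (rule exp_ge_add_one_self)
        also have "\<dots> = pmf ?p z / pmf p z"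
          using pz q by (simp add: exp_diff pq)
        finally have "(1 + (v - ?l z)) * pmf p z \<le> pmf ?p z"
          using pz by (simp add: pos_le_divide_eq)
        then have "lam * ((1 + (v - ?l z)) * pmf p z) \<le> lam * pmf ?p z"
          using lam by (intro mult_left_mono) auto
        moreover have "lam * v = \<alpha> (fst z) + \<beta> (snd z) - ?C z"
          using lam by (simp add: v_def)
        then have "(\<alpha> (fst z) + \<beta> (snd z)) * pmf p z = lam * v * pmf p z + ?C z * pmf p z"
          by (simp add: distrib_right left_diff_distrib)
        ultimately show ?thesis
          by (simp add: algebra_simps)
      qed
    qed
    also have "\<dots> = measure_pmf.expectation p (\<lambda>z. ?C z + lam * ?l z)"
      by (simp add: integral_pmf_eq_count_space)
    also have "\<dots> = measure_pmf.expectation p ?C + lam * measure_pmf.expectation p ?l"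
      using marg(1)[OF p] True by simp
    finally show ?thesis
      using True by (simp add: mutual_info_eq Let_def pairing_pmf)
  qed
  have opt: "?p \<in> couplings r s"
    by (simp add: couplings_def map_fst_opt_coupling[OF sol] map_snd_opt_coupling[OF sol])
  have "?J ?p = ereal ?V"
  proof -
    let ?l = "\<lambda>z. ln (pmf ?p z / pmf (pair_pmf r s) z)"
    let ?k = "\<lambda>z. (\<alpha> (fst z) + \<beta> (snd z) - (case z of (x, y) \<Rightarrow> c x y)) / lam"
    have ae: "AE z in measure_pmf ?p. ?l z = ?k z"
    proof (unfold AE_measure_pmf_iff, intro ballI)
      fix z assume "z \<in> set_pmf ?p"
      then have "pmf (pair_pmf r s) z \<noteq> 0"
        by (auto simp: set_pmf_iff pmf_opt_coupling[OF sol])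
      then show "?l z = ?k z"
        by (simp add: pmf_opt_coupling[OF sol] gibbs_def split_beta)
    qed
    have ik: "integrable (measure_pmf ?p) ?k"
      using marg(1,2)[OF opt] by auto
    have il: "integrable (measure_pmf ?p) ?l"
      using ik by (subst integrable_cong_AE[OF _ _ ae]) auto
    have "measure_pmf.expectation ?p ?l = measure_pmf.expectation ?p ?k"
      by (rule integral_cong_AE) (use ae in auto)
    also have "\<dots> = (?V - measure_pmf.expectation ?p (\<lambda>(x, y). c x y)) / lam"
      using marg[OF opt] by simp
    finally have "lam * measure_pmf.expectation ?p ?l = ?V - measure_pmf.expectation ?p (\<lambda>(x, y). c x y)"
      using lam by simp
    then show ?thesis
      using il by (simp add: mutual_info_eq Let_def pairing_pmf)
  qed
  then have "(INF p\<in>couplings r s. ?J p) = ereal ?V"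
    using lower opt by (intro antisym INF_greatest) (auto intro: INF_lower2)
  then show ?thesis
    by (simp add: EROT_def)
qed

subsection \<open>Entropic transforms and uniqueness of potentials\<close>

text \<open>The soft minimum over \<open>y\<close> of \<open>c x y - \<beta> y\<close>, the entropic
  version of the c-transform.\<close>

definition entropic_transform :: "real \<Rightarrow> ('x \<Rightarrow> 'y \<Rightarrow> real) \<Rightarrow> 'y pmf \<Rightarrow> ('y \<Rightarrow> real) \<Rightarrow> 'x \<Rightarrow> real" where
  "entropic_transform lam c s \<beta> x =
     - lam * ln (measure_pmf.expectation s (\<lambda>y. exp ((\<beta> y - c x y) / lam)))"

lemma gibbs_factor: "gibbs lam c \<alpha> \<beta> x y = exp (\<alpha> x / lam) * exp ((\<beta> y - c x y) / lam)"
  by (simp add: gibbs_def add_divide_distrib diff_divide_distrib flip: exp_add)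

text \<open>The value \<open>\<alpha> x\<close> enters the integral over \<open>y\<close> only
  through the constant factor \<open>exp (\<alpha> x / lam)\<close>, so the normalization can be
  solved for it.\<close>

lemma gibbs_integral_eq_one_iff:
  assumes lam: "lam > 0" and int: "integrable (measure_pmf s) (\<lambda>y. exp ((\<beta> y - c x y) / lam))"
  shows "measure_pmf.expectation s (\<lambda>y. gibbs lam c \<alpha> \<beta> x y) = 1 \<longleftrightarrow> \<alpha> x = entropic_transform lam c s \<beta> x"
proof -
  let ?I = "measure_pmf.expectation s (\<lambda>y. exp ((\<beta> y - c x y) / lam))"
  have pos: "?I > 0"
    using int by (rule integral_pmf_pos) simp
  have "measure_pmf.expectation s (\<lambda>y. gibbs lam c \<alpha> \<beta> x y) = exp (\<alpha> x / lam) * ?I"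
    by (simp add: gibbs_factor)
  also have "\<dots> = exp (\<alpha> x / lam + ln ?I)"
    using pos by (simp add: exp_add)
  finally have "measure_pmf.expectation s (\<lambda>y. gibbs lam c \<alpha> \<beta> x y) = 1 \<longleftrightarrow> \<alpha> x / lam + ln ?I = 0"
    by simp
  also have "\<dots> \<longleftrightarrow> \<alpha> x = entropic_transform lam c s \<beta> x"
    using lam by (auto simp: entropic_transform_def field_simps)
  finally show ?thesis .
qed

lemma gibbs_integrable_iff:
  "integrable (measure_pmf s) (\<lambda>y. gibbs lam c \<alpha> \<beta> x y) \<longleftrightarrow>
    integrable (measure_pmf s) (\<lambda>y. exp ((\<beta> y - c x y) / lam))"
  by (simp add: gibbs_factor)

lemma schrodinger_iff_transform:
  assumes "lam > 0"
  shows "schrodinger lam c r s \<alpha> \<beta> \<longleftrightarrow>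
     integrable (measure_pmf r) \<alpha> \<and> integrable (measure_pmf s) \<beta> \<and>
     (\<forall>x. integrable (measure_pmf s) (\<lambda>y. exp ((\<beta> y - c x y) / lam)) \<and>
          \<alpha> x = entropic_transform lam c s \<beta> x) \<and>
     (\<forall>y. integrable (measure_pmf r) (\<lambda>x. exp ((\<alpha> x - c x y) / lam)) \<and>
          \<beta> y = entropic_transform lam (\<lambda>y x. c x y) r \<alpha> y)"
proof -
  have "gibbs lam c \<alpha> \<beta> x y = gibbs lam (\<lambda>y x. c x y) \<beta> \<alpha> y x" for x y
    by (simp add: gibbs_def add.commute)
  then have "(integrable (measure_pmf r) (\<lambda>x. gibbs lam c \<alpha> \<beta> x y) \<and>
          measure_pmf.expectation r (\<lambda>x. gibbs lam c \<alpha> \<beta> x y) = 1) \<longleftrightarrow>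
     (integrable (measure_pmf r) (\<lambda>x. exp ((\<alpha> x - c x y) / lam)) \<and>
          \<beta> y = entropic_transform lam (\<lambda>y x. c x y) r \<alpha> y)" for y
    using gibbs_integral_eq_one_iff[OF assms, of r \<alpha> "\<lambda>y x. c x y" y \<beta>]
      gibbs_integrable_iff[of r lam "\<lambda>y x. c x y" \<beta> \<alpha> y] by auto
  moreover have "(integrable (measure_pmf s) (\<lambda>y. gibbs lam c \<alpha> \<beta> x y) \<and>
          measure_pmf.expectation s (\<lambda>y. gibbs lam c \<alpha> \<beta> x y) = 1) \<longleftrightarrow>
     (integrable (measure_pmf s) (\<lambda>y. exp ((\<beta> y - c x y) / lam)) \<and>
          \<alpha> x = entropic_transform lam c s \<beta> x)" for x
    using gibbs_integral_eq_one_iff[OF assms, of s \<beta> c x \<alpha>] gibbs_integrable_iff[of s lam c \<alpha> \<beta> x] by auto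
  ultimately show ?thesis
    by (simp add: schrodinger_def)
qed

lemma schrodinger_transform_fst:
  assumes "lam > 0" "schrodinger lam c r s \<alpha> \<beta>"
  shows "entropic_transform lam c s \<beta> x = \<alpha> x"
  using schrodingerD(3,4)[OF assms(2), of x] gibbs_integral_eq_one_iff[OF assms(1), of s \<beta> c x \<alpha>]
  unfolding gibbs_integrable_iff by simp

lemmas schrodinger_transform =
  schrodinger_transform_fst schrodinger_transform_fst[OF _ schrodinger_swap]

lemma EROT_potentials_transform:
  assumes "EROT_potentials lam c r s \<alpha> \<beta>"
  shows "x \<notin> set_pmf r \<Longrightarrow> \<alpha> x = entropic_transform lam c s \<beta> x"
    and "y \<notin> set_pmf s \<Longrightarrow> \<beta> y = entropic_transform lam (\<lambda>y x. c x y) r \<alpha> y"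
  unfolding entropic_transform_def integral_pmf_eq_infsum
  by (fact assms[unfolded EROT_potentials_def, THEN conjunct2, THEN conjunct2, THEN conjunct2, THEN conjunct1, rule_format]
      assms[unfolded EROT_potentials_def, THEN conjunct2, THEN conjunct2, THEN conjunct2, THEN conjunct2, rule_format])+

lemma EROT_potentials_integrable:
  assumes "EROT_potentials lam c r s \<alpha> \<beta>"
  shows "integrable (measure_pmf r) \<alpha>" "integrable (measure_pmf s) \<beta>"
  by (fact assms[unfolded EROT_potentials_def mem_ell1_pmf, THEN conjunct1]
      assms[unfolded EROT_potentials_def mem_ell1_pmf, THEN conjunct2, THEN conjunct1])+

lemma EROT_potentials_maximal:
  assumes "EROT_potentials lam c r s \<alpha> \<beta>" "integrable (measure_pmf r) \<alpha>'" "integrable (measure_pmf s) \<beta>'"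
  shows "dual_objective lam c r s \<alpha>' \<beta>' \<le> dual_objective lam c r s \<alpha> \<beta>"
  by (rule assms(1)[unfolded EROT_potentials_def mem_ell1_pmf, THEN conjunct2, THEN conjunct2, THEN conjunct1,
        THEN bspec, THEN bspec]) (simp_all add: mem_ell1_pmf assms)

lemma schrodinger_EROT_potentials:
  assumes lam: "lam > 0" and sol: "schrodinger lam c r s \<alpha> \<beta>"
  shows "EROT_potentials lam c r s \<alpha> \<beta>"
  unfolding EROT_potentials_def
proof (intro conjI ballI allI impI)
  show "\<alpha> \<in> ell1 (pmf r)" "\<beta> \<in> ell1 (pmf s)"
    using schrodingerD[OF sol] by (simp_all add: mem_ell1_pmf)
  fix \<alpha>' \<beta>' assume "\<alpha>' \<in> ell1 (pmf r)" "\<beta>' \<in> ell1 (pmf s)"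
  then show "dual_objective lam c r s \<alpha>' \<beta>' \<le> dual_objective lam c r s \<alpha> \<beta>"
    using dual_gap(1)[OF lam sol, of \<alpha>' \<beta>'] gibbs_pair_integral[OF sol]
    by (simp add: mem_ell1_pmf dual_objective_eq Let_def)
next
  have T: "\<And>x. \<alpha> x = entropic_transform lam c s \<beta> x" "\<And>y. \<beta> y = entropic_transform lam (\<lambda>y x. c x y) r \<alpha> y"
    using sol unfolding schrodinger_iff_transform[OF lam] by blast+
  show "\<alpha> x = - lam * ln (\<Sum>\<^sub>\<infinity>y. exp ((\<beta> y - c x y) / lam) * pmf s y)" for x
    using T(1)[of x] by (simp add: entropic_transform_def integral_pmf_eq_infsum)
  show "\<beta> y = - lam * ln (\<Sum>\<^sub>\<infinity>x. exp ((\<alpha> x - c x y) / lam) * pmf r x)" for y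
    using T(2)[of y] by (simp add: entropic_transform_def integral_pmf_eq_infsum)
qed

lemma entropic_transform_cong:
  assumes "\<And>y. y \<in> set_pmf s \<Longrightarrow> \<beta> y = \<beta>' y"
  shows "entropic_transform lam c s \<beta> x = entropic_transform lam c s \<beta>' x"
proof -
  have "measure_pmf.expectation s (\<lambda>y. exp ((\<beta> y - c x y) / lam)) =
      measure_pmf.expectation s (\<lambda>y. exp ((\<beta>' y - c x y) / lam))"
    by (rule integral_cong_AE) (auto simp: AE_measure_pmf_iff assms)
  then show ?thesis
    by (simp add: entropic_transform_def)
qed

text \<open>A maximizer attains equality in \<open>dual_gap\<close>, so the sum of the two
  differences vanishes on the product of the supports and each difference is constant there. Off the
  supports both pairs are given by transforms, which see only values on the supports, and these
  carry the shift over.\<close>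

lemma EROT_potentials_unique:
  assumes lam: "lam > 0" and sol: "schrodinger lam c r s \<alpha> \<beta>" and pot: "EROT_potentials lam c r s \<alpha>' \<beta>'"
  obtains \<eta> where "\<alpha>' = (\<lambda>x. \<alpha> x + \<eta>)" "\<beta>' = (\<lambda>y. \<beta> y - \<eta>)"
proof -
  note int = EROT_potentials_integrable[OF pot]
  let ?g = "\<lambda>(x, y). gibbs lam c \<alpha>' \<beta>' x y"
  \<comment> \<open>The objective is finite at the Schrodinger solution, so it is not
    \<open>- \<infinity>\<close> at the maximizer, whose kernel is therefore integrable.\<close>
  have "dual_objective lam c r s \<alpha> \<beta> \<le> dual_objective lam c r s \<alpha>' \<beta>'"
    using EROT_potentials_maximal[OF pot schrodingerD(1,2)[OF sol]] .
  then have g: "integrable (measure_pmf (pair_pmf r s)) ?g"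
    and ge: "measure_pmf.expectation r \<alpha> + measure_pmf.expectation s \<beta>
      \<le> measure_pmf.expectation r \<alpha>' + measure_pmf.expectation s \<beta>'
        - lam * (measure_pmf.expectation (pair_pmf r s) ?g - 1)"
    using gibbs_pair_integral[OF sol] by (auto simp: dual_objective_eq Let_def split: if_splits)
  note gap = dual_gap[OF lam sol int g]
  have eq: "\<alpha>' x - \<alpha> x + (\<beta>' y - \<beta> y) = 0" if "x \<in> set_pmf r" "y \<in> set_pmf s" for x y
    using gap(2)[OF antisym[OF gap(1) ge] that] .
  obtain x0 where x0: "x0 \<in> set_pmf r"
    using set_pmf_not_empty[of r] by blast
  obtain y0 where y0: "y0 \<in> set_pmf s"
    using set_pmf_not_empty[of s] by blast
  define \<eta> where "\<eta> = \<alpha>' x0 - \<alpha> x0"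
  have b: "\<beta>' y = \<beta> y - \<eta>" if "y \<in> set_pmf s" for y
    using eq[OF x0 that] by (simp add: \<eta>_def)
  have a: "\<alpha>' x = \<alpha> x + \<eta>" if "x \<in> set_pmf r" for x
    using eq[OF that y0] b[OF y0] by simp
  have shift: "schrodinger lam c r s (\<lambda>x. \<alpha> x + \<eta>) (\<lambda>y. \<beta> y - \<eta>)"
    using sol by (rule schrodinger_shift)
  have A: "\<alpha>' x = \<alpha> x + \<eta>" for x
  proof (cases "x \<in> set_pmf r")
    case False
    then have "\<alpha>' x = entropic_transform lam c s \<beta>' x"
      by (rule EROT_potentials_transform(1)[OF pot])
    also have "\<dots> = entropic_transform lam c s (\<lambda>y. \<beta> y - \<eta>) x"
      by (rule entropic_transform_cong) (rule b)
    also have "\<dots> = \<alpha> x + \<eta>"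
      by (rule schrodinger_transform(1)[OF lam shift])
    finally show ?thesis .
  qed (rule a)
  have B: "\<beta>' y = \<beta> y - \<eta>" for y
  proof (cases "y \<in> set_pmf s")
    case False
    then have "\<beta>' y = entropic_transform lam (\<lambda>y x. c x y) r \<alpha>' y"
      by (rule EROT_potentials_transform(2)[OF pot])
    also have "\<dots> = entropic_transform lam (\<lambda>y x. c x y) r (\<lambda>x. \<alpha> x + \<eta>) y"
      by (rule entropic_transform_cong) (rule a)
    also have "\<dots> = \<beta> y - \<eta>"
      by (rule schrodinger_transform(2)[OF lam shift])
    finally show ?thesis .
  qed (rule b)
  show thesis
    by (rule that[of \<eta>]) (rule ext, rule A, rule ext, rule B)
qed

section \<open>Bounds and limits of entropic transforms\<close>

lemma exp_weight_nonneg: "0 \<le> exp_weight lam cm cp z"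
  by (simp add: exp_weight_def)

lemma abs_weight_ge: "1 \<le> abs_weight cm cp z" "\<bar>cm z\<bar> \<le> abs_weight cm cp z" "\<bar>cp z\<bar> \<le> abs_weight cm cp z"
  by (simp_all add: abs_weight_def)

lemma abs_weight_nonneg: "0 \<le> abs_weight cm cp z"
  using abs_weight_ge(1)[of cm cp z] by simp

lemma abs_le_abs_weight:
  assumes "cm z - k \<le> a" "a \<le> cp z + k" "0 \<le> k"
  shows "\<bar>a\<bar> \<le> (1 + k) * abs_weight cm cp z"
proof -
  have "\<bar>a\<bar> \<le> abs_weight cm cp z + k * 1"
    using assms by (auto simp: abs_weight_def)
  also have "\<dots> \<le> abs_weight cm cp z + k * abs_weight cm cp z"
    using assms(3) abs_weight_ge(1)[of cm cp z] by (intro add_left_mono mult_left_mono) auto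
  finally show ?thesis
    by (simp add: distrib_right)
qed

lemma integrable_abs_weightD:
  assumes "integrable (measure_pmf r) (abs_weight cm cp)"
  shows "integrable (measure_pmf r) cm" "integrable (measure_pmf r) cp"
  by (rule integrable_pmf_bound[OF assms]; simp add: abs_weight_ge)+

text \<open>This is where exponential weights arise: bounding \<open>\<beta>\<close> above by
  \<open>cYp\<close> and \<open>c\<close> below by \<open>cYm\<close> of the same collection leaves
  \<open>cYp y - cYm y\<close> in the exponent.\<close>

lemma transform_integrand_le:
  assumes lam: "lam > 0" and dom: "cXm x + cYm y \<le> c x y" and \<beta>: "\<beta> y \<le> cYp y + k"
  shows "exp ((\<beta> y - c x y) / lam) \<le> exp ((k - cXm x) / lam) * exp_weight lam cYm cYp y"
proof -
  have "(\<beta> y - c x y) / lam \<le> (k - cXm x + (cYp y - cYm y)) / lam"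
    using assms by (intro divide_right_mono) auto
  then show ?thesis
    by (simp add: exp_weight_def add_divide_distrib flip: exp_add)
qed

lemma transform_integrable:
  assumes lam: "lam > 0" and dom: "\<And>y. cXm x + cYm y \<le> c x y" and \<beta>: "\<And>y. \<beta> y \<le> cYp y + k"
    and w: "integrable (measure_pmf s) (exp_weight lam cYm cYp)"
  shows "integrable (measure_pmf s) (\<lambda>y. exp ((\<beta> y - c x y) / lam))"
proof (rule integrable_pmf_bound)
  show "integrable (measure_pmf s) (\<lambda>y. exp ((k - cXm x) / lam) * exp_weight lam cYm cYp y)"
    using w by simp
  show "\<bar>exp ((\<beta> y - c x y) / lam)\<bar> \<le> exp ((k - cXm x) / lam) * exp_weight lam cYm cYp y" for y
    unfolding abs_exp_cancel using lam dom \<beta> by (rule transform_integrand_le)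
qed

text \<open>Jensen's inequality bounds the integral below by the exponential of a mean, so only the
  mean of \<open>\<beta>\<close> enters and no exponential moment is spent.\<close>

lemma transform_upper:
  assumes lam: "lam > 0" and dom: "\<And>y. c x y \<le> cXp x + cYp y"
    and int: "integrable (measure_pmf s) (\<lambda>y. exp ((\<beta> y - c x y) / lam))"
    and \<beta>: "integrable (measure_pmf s) \<beta>" and p: "integrable (measure_pmf s) cYp"
  shows "entropic_transform lam c s \<beta> x
      \<le> cXp x + measure_pmf.expectation s cYp - measure_pmf.expectation s \<beta>"
proof -
  let ?I = "measure_pmf.expectation s (\<lambda>y. exp ((\<beta> y - c x y) / lam))"
  let ?f = "\<lambda>y. (\<beta> y - cXp x - cYp y) / lam"
  have le: "exp (?f y) \<le> exp ((\<beta> y - c x y) / lam)" for y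
    using dom[of y] lam by (simp add: divide_right_mono)
  have f: "integrable (measure_pmf s) ?f"
    using \<beta> p by auto
  have ef: "integrable (measure_pmf s) (\<lambda>y. exp (?f y))"
    by (rule integrable_pmf_bound[OF int]) (use le in simp)
  have "exp (measure_pmf.expectation s ?f) \<le> measure_pmf.expectation s (\<lambda>y. exp (?f y))"
    by (rule exp_jensen_pmf[OF f ef])
  also have "\<dots> \<le> ?I"
    using ef int le by (rule integral_mono)
  finally have *: "exp (measure_pmf.expectation s ?f) \<le> ?I" .
  then have "measure_pmf.expectation s ?f \<le> ln ?I"
    using less_le_trans[OF exp_gt_zero *] by (simp only: ln_ge_iff)
  then have "lam * measure_pmf.expectation s ?f \<le> lam * ln ?I"
    using lam by (simp only: mult_left_mono less_imp_le)
  moreover have "lam * measure_pmf.expectation s ?f =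
      measure_pmf.expectation s \<beta> - cXp x - measure_pmf.expectation s cYp"
    using lam \<beta> p by simp
  ultimately show ?thesis
    by (simp add: entropic_transform_def)
qed

text \<open>Averaging \<open>transform_integrand_le\<close> turns an upper bound on
  \<open>\<beta>\<close> into a lower bound on its transform. One and the same collection must bound
  \<open>\<beta>\<close> above and \<open>c\<close> below.\<close>

lemma transform_lower:
  assumes lam: "lam > 0" and dom: "\<And>y. cXm x + cYm y \<le> c x y" and \<beta>: "\<And>y. \<beta> y \<le> cYp y + k"
    and w: "integrable (measure_pmf s) (exp_weight lam cYm cYp)"
  shows "cXm x - k - lam * ln (measure_pmf.expectation s (exp_weight lam cYm cYp))
      \<le> entropic_transform lam c s \<beta> x"
proof -
  let ?I = "measure_pmf.expectation s (\<lambda>y. exp ((\<beta> y - c x y) / lam))"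
  let ?W = "measure_pmf.expectation s (exp_weight lam cYm cYp)"
  have int: "integrable (measure_pmf s) (\<lambda>y. exp ((\<beta> y - c x y) / lam))"
    using lam dom \<beta> w by (rule transform_integrable)
  have I: "0 < ?I" and W: "0 < ?W"
    using int w by (auto intro!: integral_pmf_pos simp: exp_weight_def)
  have "?I \<le> measure_pmf.expectation s (\<lambda>y. exp ((k - cXm x) / lam) * exp_weight lam cYm cYp y)"
  proof (rule integral_mono)
    show "exp ((\<beta> y - c x y) / lam) \<le> exp ((k - cXm x) / lam) * exp_weight lam cYm cYp y" for y
      using lam dom \<beta> by (rule transform_integrand_le)
  qed (use int w in auto)
  also have "\<dots> = exp ((k - cXm x) / lam + ln ?W)"
    using W by (simp add: exp_add)
  finally have "ln ?I \<le> ln (exp ((k - cXm x) / lam + ln ?W))"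
    using I by (simp only: ln_le_cancel_iff exp_gt_zero)
  then have "ln ?I \<le> (k - cXm x) / lam + ln ?W"
    by (simp only: ln_exp)
  then have "lam * ln ?I \<le> lam * ((k - cXm x) / lam + ln ?W)"
    using lam by (simp only: mult_left_mono less_imp_le)
  also have "\<dots> = k - cXm x + lam * ln ?W"
    using lam by (simp add: distrib_left)
  finally show ?thesis
    by (simp add: entropic_transform_def)
qed

text \<open>The exponential weight dominates all integrands simultaneously, and the limit integral
  is positive, so \<open>ln\<close> is continuous there.\<close>

lemma transform_tendsto:
  fixes c :: "'x \<Rightarrow> 'y::countable \<Rightarrow> real"
  assumes lam: "lam > 0" and dom: "\<And>y. cXm x + cYm y \<le> c x y"
    and \<beta>n: "\<And>n y. \<beta>' n y \<le> cYp y + k" and lim: "\<And>y. (\<lambda>n. \<beta>' n y) \<longlonglongrightarrow> \<beta> y"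
    and conv: "pmf_conv (exp_weight lam cYm cYp) S s"
  shows "(\<lambda>n. entropic_transform lam c (S n) (\<beta>' n) x) \<longlonglongrightarrow> entropic_transform lam c s \<beta> x"
    and "integrable (measure_pmf s) (\<lambda>y. exp ((\<beta> y - c x y) / lam))"
proof -
  have bd: "\<bar>exp ((\<beta>' n y - c x y) / lam)\<bar> \<le> exp ((k - cXm x) / lam) * exp_weight lam cYm cYp y" for n y
    unfolding abs_exp_cancel using lam dom \<beta>n by (rule transform_integrand_le)
  have l: "(\<lambda>n. exp ((\<beta>' n y - c x y) / lam)) \<longlonglongrightarrow> exp ((\<beta> y - c x y) / lam)" for y
    using lam by (intro tendsto_intros lim) auto
  note C = pmf_conv_integral[OF conv exp_weight_nonneg bd l]
  show int: "integrable (measure_pmf s) (\<lambda>y. exp ((\<beta> y - c x y) / lam))"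
    by (rule C(2))
  have "0 < measure_pmf.expectation s (\<lambda>y. exp ((\<beta> y - c x y) / lam))"
    using int by (rule integral_pmf_pos) simp
  then show "(\<lambda>n. entropic_transform lam c (S n) (\<beta>' n) x) \<longlonglongrightarrow> entropic_transform lam c s \<beta> x"
    unfolding entropic_transform_def using C(1) by (intro tendsto_intros) auto
qed

section \<open>Pointwise compactness and subsequences\<close>

lemma pointwise_bounded_convergent_subseq:
  fixes f :: "nat \<Rightarrow> 'a::countable \<Rightarrow> real"
  assumes bd: "\<And>n x. \<bar>f n x\<bar> \<le> B x"
  obtains k l where "strict_mono (k :: nat \<Rightarrow> nat)" "\<And>x. (\<lambda>n. f (k n) x) \<longlonglongrightarrow> l x"
proof -
  let ?P = "\<lambda>i g. convergent (\<lambda>n. f (g n) (from_nat i))"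
  have ex: "\<exists>r. strict_mono r \<and> ?P i (g \<circ> r)" if "strict_mono g" for i and g :: "nat \<Rightarrow> nat"
  proof -
    have "bounded (range (\<lambda>n. f (g n) (from_nat i)))"
      by (rule boundedI[of _ "B (from_nat i)"]) (use bd in auto)
    then obtain l r where "strict_mono (r :: nat \<Rightarrow> nat)" "((\<lambda>n. f (g n) (from_nat i)) \<circ> r) \<longlonglongrightarrow> l"
      using bounded_imp_convergent_subsequence by blast
    then show ?thesis
      by (intro exI[of _ r]) (auto simp: o_def intro: convergentI)
  qed
  interpret subseqs ?P
    by unfold_locales (rule ex)
  \<comment> \<open>From index \<open>Suc i\<close> on, the diagonal sequence is a subsequence of
    the one selected for point \<open>i\<close>; the initial segment does not affect
    convergence.\<close>
  have "?P i (diagseq \<circ> ((+) (Suc i)))" for i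
  proof (rule diagseq_holds)
    fix n and s r :: "nat \<Rightarrow> nat"
    assume "strict_mono r" "?P n s"
    then show "?P n (s \<circ> r)"
      using convergent_subseq_convergent[of "\<lambda>i. f (s i) (from_nat n)" r] by (simp add: o_def)
  qed
  then have "convergent (\<lambda>n. f (diagseq (Suc i + n)) (from_nat i))" for i
    by (simp add: o_def)
  then have conv: "convergent (\<lambda>n. f (diagseq n) (from_nat i))" for i
    using convergent_ignore_initial_segment[of "\<lambda>n. f (diagseq n) (from_nat i)" "Suc i"]
    by (subst (asm) add.commute) blast
  have "convergent (\<lambda>n. f (diagseq n) x)" for x
    using conv[of "to_nat x"] by simp
  then have "(\<lambda>n. f (diagseq n) x) \<longlonglongrightarrow> lim (\<lambda>n. f (diagseq n) x)" for x
    by (simp add: convergent_LIMSEQ_iff)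
  then show thesis
    by (rule that[OF subseq_diagseq])
qed

subsection \<open>Existence of potentials\<close>

lemma pointwise_bounded_convergent_subseq2:
  fixes f :: "nat \<Rightarrow> 'a::countable \<Rightarrow> real" and g :: "nat \<Rightarrow> 'b::countable \<Rightarrow> real"
  assumes f: "\<And>n x. \<bar>f n x\<bar> \<le> B x" and g: "\<And>n y. \<bar>g n y\<bar> \<le> B' y"
  obtains k l l' where "strict_mono (k :: nat \<Rightarrow> nat)" "\<And>x. (\<lambda>n. f (k n) x) \<longlonglongrightarrow> l x"
    "\<And>y. (\<lambda>n. g (k n) y) \<longlonglongrightarrow> l' y"
proof -
  \<comment> \<open>Viewing the two families as one on the disjoint union lets a single extraction
    serve both.\<close>
  have "\<bar>case_sum (f n) (g n) z\<bar> \<le> case_sum B B' z" for n z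
    using f g by (cases z) auto
  then obtain k l where k: "strict_mono (k :: nat \<Rightarrow> nat)"
    and l: "\<And>z. (\<lambda>n. case_sum (f (k n)) (g (k n)) z) \<longlonglongrightarrow> l z"
    by (rule pointwise_bounded_convergent_subseq[of "\<lambda>n. case_sum (f n) (g n)"]) (rule that)
  show thesis
    by (rule that[OF k, of "\<lambda>x. l (Inl x)" "\<lambda>y. l (Inr y)"]) (use l[of "Inl _"] l[of "Inr _"] in auto)
qed

text \<open>The selection \<open>k'\<close> may be arbitrary: if convergence fails, \<open>k\<close>
  can enumerate the indices at distance at least \<open>e\<close>, and then \<open>k'\<close> never
  reaches a good index.\<close>

lemma tendsto_subsubseqI:
  fixes X :: "nat \<Rightarrow> real"
  assumes "\<And>k. strict_mono (k :: nat \<Rightarrow> nat) \<Longrightarrow> \<exists>k'. (\<lambda>n. X (k (k' n))) \<longlonglongrightarrow> l"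
  shows "X \<longlonglongrightarrow> l"
proof (rule ccontr)
  assume "\<not> X \<longlonglongrightarrow> l"
  then obtain e where e: "e > 0" and "\<not> (\<exists>N. \<forall>n\<ge>N. dist (X n) l < e)"
    unfolding lim_sequentially by blast
  then have inf: "infinite {n. e \<le> dist (X n) l}"
    unfolding infinite_nat_iff_unbounded_le by (auto simp: not_less)
  let ?k = "enumerate {n. e \<le> dist (X n) l}"
  obtain k' where "(\<lambda>n. X (?k (k' n))) \<longlonglongrightarrow> l"
    using assms[OF strict_mono_enumerate[OF inf]] by blast
  then have "\<forall>\<^sub>F n in sequentially. dist (X (?k (k' n))) l < e"
    using e by (rule tendstoD)
  then obtain n where "dist (X (?k (k' n))) l < e"
    using eventually_happens trivial_limit_sequentially by blast
  moreover have "?k (k' n) \<in> {n. e \<le> dist (X n) l}"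
    using enumerate_in_set[OF inf] .
  ultimately show False
    by simp
qed

lemma LIMSEQ_bdd_above:
  fixes X :: "nat \<Rightarrow> real"
  assumes "X \<longlonglongrightarrow> l"
  obtains K where "\<And>n. X n \<le> K"
proof -
  have "Bseq X"
    using assms convergentI convergent_imp_Bseq by blast
  then obtain K where "\<And>n. norm (X n) \<le> K"
    by (auto simp: Bseq_def)
  then show thesis
    by (intro that[of K]) (simp add: abs_le_iff)
qed

text \<open>
  The integral of \<open>exp ((A - A') / lam)\<close> against \<open>r\<close> equals \<open>1\<close>, so \<open>exp u \<ge> 1 + u\<close> applies.
\<close>

lemma sinkhorn_step_mean:
  assumes lam: "lam > 0"
    and iA: "\<And>y. integrable (measure_pmf r) (\<lambda>x. exp ((A x - c x y) / lam))"
    and B: "\<And>y. B y = entropic_transform lam (\<lambda>y x. c x y) r A y"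
    and iB: "\<And>x. integrable (measure_pmf s) (\<lambda>y. exp ((B y - c x y) / lam))"
    and A': "\<And>x. A' x = entropic_transform lam c s B x"
    and int: "integrable (measure_pmf r) A" "integrable (measure_pmf r) A'"
  shows "measure_pmf.expectation r A \<le> measure_pmf.expectation r A'"
    and "measure_pmf.expectation r A = measure_pmf.expectation r A' \<Longrightarrow> x \<in> set_pmf r \<Longrightarrow> A x = A' x"
proof -
  let ?f = "gibbs lam c A B"
  have sym: "?f x y = gibbs lam (\<lambda>y x. c x y) B A y x" for x y
    by (simp add: gibbs_def add.commute)
  have 1: "measure_pmf.expectation r (\<lambda>x. ?f x y) = 1" for y
    unfolding sym by (subst gibbs_integral_eq_one_iff[where c = "\<lambda>y x. c x y", OF lam iA]) (rule B)
  have 2: "integrable (measure_pmf r) (\<lambda>x. ?f x y)" for y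
    unfolding sym gibbs_integrable_iff by (rule iA)
  have 3: "integrable (measure_pmf s) (?f x)" for x
    unfolding gibbs_integrable_iff by (rule iB)
  define u where "u = (\<lambda>x. (A x - A' x) / lam)"
  \<comment> \<open>With \<open>A'\<close> in place of \<open>A\<close> the integral over
    \<open>y\<close> is one; exchanging them leaves the factor \<open>exp (u x)\<close>.\<close>
  have g: "measure_pmf.expectation s (?f x) = exp (u x)" for x
  proof -
    have "measure_pmf.expectation s (\<lambda>y. gibbs lam c A' B x y) = 1"
      by (subst gibbs_integral_eq_one_iff[where c = c, OF lam iB]) (rule A')
    moreover have "?f x = (\<lambda>y. exp (u x) * gibbs lam c A' B x y)"
      by (auto simp: gibbs_def u_def add_divide_distrib diff_divide_distrib simp flip: exp_add)
    ultimately show ?thesis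
      by simp
  qed
  note sw = pair_pmf_swap_integral(3,4)[where f = ?f and r = r and s = s, OF gibbs_nonneg 2 1 3, unfolded g]
  have iu: "integrable (measure_pmf r) u"
    unfolding u_def using int by auto
  have i: "integrable (measure_pmf r) (\<lambda>x. exp (u x) - (1 + u x))"
    using sw(1) iu by auto
  have nn: "0 \<le> exp (u x) - (1 + u x)" for x
    using exp_ge_add_one_self[of "u x"] by simp
  have e: "measure_pmf.expectation r (\<lambda>x. exp (u x) - (1 + u x)) = - measure_pmf.expectation r u"
    using sw iu by simp
  have eu: "measure_pmf.expectation r u = (measure_pmf.expectation r A - measure_pmf.expectation r A') / lam"
    using int by (simp add: u_def)
  have "0 \<le> measure_pmf.expectation r (\<lambda>x. exp (u x) - (1 + u x))"
    using nn by (intro integral_nonneg_AE) simp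
  then show "measure_pmf.expectation r A \<le> measure_pmf.expectation r A'"
    unfolding e eu using lam by (simp add: divide_le_0_iff)
  assume eq: "measure_pmf.expectation r A = measure_pmf.expectation r A'" and x: "x \<in> set_pmf r"
  have "measure_pmf.expectation r (\<lambda>x. exp (u x) - (1 + u x)) = 0"
    unfolding e eu using eq by simp
  then have "AE x in measure_pmf r. exp (u x) - (1 + u x) = 0"
    using integral_nonneg_eq_0_iff_AE[OF i] nn by simp
  then have "exp (u x) = 1 + u x"
    using x by (auto simp: AE_measure_pmf_iff)
  then show "A x = A' x"
    using lam by (simp add: exp_eq_add_one_iff u_def)
qed

text \<open>The two collections enter asymmetrically: the first pair gives the weight of the norm,
  and the exponential moment is taken for the second. For the second space the collections are
  passed in the opposite order, as in \<open>admY\<close>.\<close>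

definition admissible ::
    "real \<Rightarrow> ('a \<Rightarrow> real) \<Rightarrow> ('a \<Rightarrow> real) \<Rightarrow> ('a \<Rightarrow> real) \<Rightarrow> ('a \<Rightarrow> real) \<Rightarrow> 'a pmf \<Rightarrow> bool" where
  "admissible lam cm cp cm' cp' r \<longleftrightarrow> integrable (measure_pmf r) (abs_weight cm cp) \<and>
     integrable (measure_pmf r) (abs_weight cm' cp') \<and> integrable (measure_pmf r) (exp_weight lam cm' cp')"

lemma admissibleD:
  assumes "admissible lam cm cp cm' cp' r"
  shows "integrable (measure_pmf r) (abs_weight cm cp)" "integrable (measure_pmf r) (exp_weight lam cm' cp')"
    "integrable (measure_pmf r) cm" "integrable (measure_pmf r) cp"
    "integrable (measure_pmf r) cm'" "integrable (measure_pmf r) cp'"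
  using assms integrable_abs_weightD unfolding admissible_def by blast+

locale erot_cost =
  fixes lam :: real and c :: "'x::countable \<Rightarrow> 'y::countable \<Rightarrow> real"
    and cXm cXp :: "'x \<Rightarrow> real" and cYm cYp :: "'y \<Rightarrow> real"
    and cXm' cXp' :: "'x \<Rightarrow> real" and cYm' cYp' :: "'y \<Rightarrow> real"
  assumes lam: "lam > 0" and dom: "dominating c cXm cXp cYm cYp"
    and dom': "dominating c cXm' cXp' cYm' cYp'"
begin

lemma c_le: "c x y \<le> cXp x + cYp y" "c x y \<le> cXp' x + cYp' y"
  and c_ge: "cXm x + cYm y \<le> c x y" "cXm' x + cYm' y \<le> c x y"
  and cXm_le: "cXm x \<le> cXp x" "cXm' x \<le> cXp' x"
  using dom dom' by (simp_all add: dominating_def)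

text \<open>The exponential moments at hand are \<open>phiX'\<close> and \<open>phiY\<close>, one
  from each collection, so the exchange of the spaces has to exchange the collections as well. Each
  result about one marginal then yields its counterpart for the other.\<close>

lemma swap: "erot_cost lam (\<lambda>y x. c x y) cYm' cYp' cXm' cXp' cYm cYp cXm cXp"
  using lam dom dom' by unfold_locales (simp_all add: dominating_def add.commute)

abbreviation "admX \<equiv> admissible lam cXm cXp cXm' cXp'"
abbreviation "admY \<equiv> admissible lam cYm' cYp' cYm cYp"

text \<open>The two upper bounds have different purposes. The unprimed one combines with the lower
  bound to domination by the norm weight; the primed one is the hypothesis under which the transform
  back to the other space can be taken.\<close>

lemma transform_bounds:
  assumes s: "admY s" and \<beta>: "integrable (measure_pmf s) \<beta>" "\<And>y. \<beta> y \<le> cYp y + k"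
  shows "integrable (measure_pmf s) (\<lambda>y. exp ((\<beta> y - c x y) / lam))"
    and "entropic_transform lam c s \<beta> x
      \<le> cXp x + (measure_pmf.expectation s cYp - measure_pmf.expectation s \<beta>)"
    and "entropic_transform lam c s \<beta> x
      \<le> cXp' x + (measure_pmf.expectation s cYp' - measure_pmf.expectation s \<beta>)"
    and "cXm x - (k + lam * ln (measure_pmf.expectation s (exp_weight lam cYm cYp)))
      \<le> entropic_transform lam c s \<beta> x"
    and "admX r \<Longrightarrow> integrable (measure_pmf r) (entropic_transform lam c s \<beta>)"
proof -
  note S = admissibleD[OF s]
  have int: "integrable (measure_pmf s) (\<lambda>y. exp ((\<beta> y - c x y) / lam))" for x
    using lam c_ge(1) \<beta>(2) S(2) by (rule transform_integrable)
  then show "integrable (measure_pmf s) (\<lambda>y. exp ((\<beta> y - c x y) / lam))" .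
  have up: "entropic_transform lam c s \<beta> x
      \<le> cXp x + measure_pmf.expectation s cYp - measure_pmf.expectation s \<beta>" for x
    using lam c_le(1) int \<beta>(1) S(6) by (rule transform_upper)
  then show "entropic_transform lam c s \<beta> x
      \<le> cXp x + (measure_pmf.expectation s cYp - measure_pmf.expectation s \<beta>)"
    by (simp add: add_diff_eq)
  have "entropic_transform lam c s \<beta> x
      \<le> cXp' x + measure_pmf.expectation s cYp' - measure_pmf.expectation s \<beta>"
    using lam c_le(2) int \<beta>(1) S(4) by (rule transform_upper)
  then show "entropic_transform lam c s \<beta> x
      \<le> cXp' x + (measure_pmf.expectation s cYp' - measure_pmf.expectation s \<beta>)"
    by simp
  have lo: "cXm x - k - lam * ln (measure_pmf.expectation s (exp_weight lam cYm cYp))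
      \<le> entropic_transform lam c s \<beta> x" for x
    using lam c_ge(1) \<beta>(2) S(2) by (rule transform_lower)
  then show "cXm x - (k + lam * ln (measure_pmf.expectation s (exp_weight lam cYm cYp)))
      \<le> entropic_transform lam c s \<beta> x"
    by (simp add: diff_diff_eq)
  assume r: "admX r"
  define K where "K = \<bar>measure_pmf.expectation s cYp - measure_pmf.expectation s \<beta>\<bar>
    + \<bar>k + lam * ln (measure_pmf.expectation s (exp_weight lam cYm cYp))\<bar>"
  show "integrable (measure_pmf r) (entropic_transform lam c s \<beta>)"
  proof (rule integrable_pmf_bound)
    show "integrable (measure_pmf r) (\<lambda>x. (1 + K) * abs_weight cXm cXp x)"
      using admissibleD(1)[OF r] by simp
    show "\<bar>entropic_transform lam c s \<beta> x\<bar> \<le> (1 + K) * abs_weight cXm cXp x" for x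
      by (rule abs_le_abs_weight) (use up[of x] lo[of x] in \<open>auto simp: K_def\<close>)
  qed
qed

text \<open>Sinkhorn iteration. Monotone means keep the upper bounds uniform, and since the sum of
  the means is bounded, they converge. Along a convergent subsequence an iterate and its successor
  thus have the same limiting mean, and the equality case of \<open>sinkhorn_step_mean\<close>
  identifies their limits on the support.\<close>

lemma exists_schrodinger:
  assumes r: "admX r" and s: "admY s"
  shows "\<exists>\<alpha> \<beta>. schrodinger lam c r s \<alpha> \<beta>"
proof -
  interpret sw: erot_cost lam "\<lambda>y x. c x y" cYm' cYp' cXm' cXp' cYm cYp cXm cXp
    by (rule swap)
  let ?TX = "entropic_transform lam c s" and ?TY = "entropic_transform lam (\<lambda>y x. c x y) r"
  let ?Er = "measure_pmf.expectation r" and ?Es = "measure_pmf.expectation s"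
  \<comment> \<open>The start \<open>cXm'\<close> is integrable and lies below \<open>cXp'\<close>,
    so the upper bound required for the first transform holds with \<open>k = 0\<close>.\<close>
  define A where "A = (\<lambda>n. ((?TX \<circ> ?TY) ^^ n) cXm')"
  define B where "B = (\<lambda>n. ?TY (A n))"
  note R = admissibleD[OF r] and S = admissibleD[OF s]
  have AS: "A (Suc n) = ?TX (B n)" for n
    by (simp add: A_def B_def)
  have ASx: "A (Suc n) x = ?TX (B n) x" and Bx: "B n y = ?TY (A n) y" for n x y
    by (simp_all add: AS B_def)
  have inv: "integrable (measure_pmf r) (A n) \<and> (\<exists>k. \<forall>x. A n x \<le> cXp' x + k)
      \<and> integrable (measure_pmf s) (B n) \<and> (\<exists>k. \<forall>y. B n y \<le> cYp y + k)" for n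
  proof (induction n)
    case 0
    have A0: "integrable (measure_pmf r) (A 0)" "\<And>x. A 0 x \<le> cXp' x + 0"
      using R(5) cXm_le by (simp_all add: A_def)
    from sw.transform_bounds(3,5)[OF r A0] A0 s show ?case
      unfolding B_def by blast
  next
    case (Suc n)
    then obtain k where B: "integrable (measure_pmf s) (B n)" "\<And>y. B n y \<le> cYp y + k"
      by blast
    note A = transform_bounds(5)[OF s B r, folded AS] transform_bounds(3)[OF s B, folded AS]
    from sw.transform_bounds(3,5)[OF r A] A s show ?case
      unfolding B_def by blast
  qed
  have iA: "integrable (measure_pmf r) (A n)" and iB: "integrable (measure_pmf s) (B n)" for n
    using inv[of n] by blast+
  have eA: "integrable (measure_pmf r) (\<lambda>x. exp ((A n x - c x y) / lam))" for n y
    using inv[of n] sw.transform_bounds(1)[OF r] by blast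
  have eB: "integrable (measure_pmf s) (\<lambda>y. exp ((B n y - c x y) / lam))" for n x
    using inv[of n] transform_bounds(1)[OF s] by blast
  define a where "a = (\<lambda>n. ?Er (A n))"
  define b where "b = (\<lambda>n. ?Es (B n))"
  have aS: "a n \<le> a (Suc n)" for n
    unfolding a_def using lam eA Bx eB ASx iA iA
    by (rule sinkhorn_step_mean(1))
  have bS: "b n \<le> b (Suc n)" for n
    unfolding b_def using lam eB ASx eA Bx iB iB
    by (rule sinkhorn_step_mean(1)[where c = "\<lambda>y x. c x y"])
  have inca: "incseq a" and incb: "incseq b"
    using aS bS by (auto intro: incseq_SucI)
  have a0: "a 0 \<le> a n" and b0: "b 0 \<le> b n" for n
    using inca incb by (auto simp: incseq_def)
  have upB: "B n y \<le> cYp y + (?Er cXp - a n)" "B n y \<le> cYp' y + (?Er cXp' - a n)" for n y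
    using inv[of n] sw.transform_bounds(2,3)[OF r] unfolding a_def B_def by blast+
  have upA: "A (Suc n) x \<le> cXp x + (?Es cYp - b n)" "A (Suc n) x \<le> cXp' x + (?Es cYp' - b n)" for n x
    using inv[of n] transform_bounds(2,3)[OF s] unfolding b_def AS by blast+
  \<comment> \<open>The upper bound on \<open>B n\<close> contains \<open>- a n\<close>, so
    integrating it bounds the sum of the two means.\<close>
  have "b n \<le> ?Es (\<lambda>y. cYp y + (?Er cXp - a n))" for n
    unfolding b_def by (rule integral_mono) (use iB S(6) upB(1) in auto)
  then have ab: "a n + b n \<le> ?Er cXp + ?Es cYp" for n
    using S(6) by (simp add: algebra_simps)
  have "a n \<le> ?Er cXp + ?Es cYp - b 0" for n
    using ab[of n] b0[of n] by simp
  then obtain L where L: "a \<longlonglongrightarrow> L"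
    using incseq_convergent[OF inca] by blast
  define K where "K = \<bar>?Er cXp - a 0\<bar> + \<bar>?Er cXp' - a 0\<bar> + \<bar>?Es cYp - b 0\<bar> + \<bar>?Es cYp' - b 0\<bar>
      + \<bar>lam * ln (?Es (exp_weight lam cYm cYp))\<bar> + \<bar>lam * ln (?Er (exp_weight lam cXm' cXp'))\<bar>"
  have K: "0 \<le> K" "lam * ln (?Es (exp_weight lam cYm cYp)) \<le> K" "lam * ln (?Er (exp_weight lam cXm' cXp')) \<le> K"
    by (auto simp: K_def intro: order_trans[OF abs_ge_self])
  have B1: "B n y \<le> cYp y + K" and B2: "B n y \<le> cYp' y + K" for n y
    using upB(1)[of n y] upB(2)[of n y] a0[of n] by (auto simp: K_def)
  have A1: "A (Suc n) x \<le> cXp x + K" and A2: "A (Suc n) x \<le> cXp' x + K" for n x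
    using upA(1)[of n x] upA(2)[of n x] b0[of n] by (auto simp: K_def)
  have A3: "cXm x - 2 * K \<le> A (Suc n) x" for n x
    using transform_bounds(4)[OF s iB B1, of x n] K(2) unfolding AS by linarith
  have B3: "cYm' y - 2 * K \<le> B (Suc n) y" for n y
    using sw.transform_bounds(4)[OF r iA A2, of y n] K(3) unfolding B_def by linarith
  \<comment> \<open>The start \<open>A 0\<close> is not itself a transform, so the two-sided bounds
    begin at index \<open>Suc n\<close>.\<close>
  have absA: "\<bar>A (Suc n) x\<bar> \<le> (1 + 2 * K) * abs_weight cXm cXp x" for n x
    by (rule abs_le_abs_weight) (use A1[of n x] A3[of x n] K in auto)
  have absB: "\<bar>B (Suc n) y\<bar> \<le> (1 + 2 * K) * abs_weight cYm' cYp' y" for n y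
    by (rule abs_le_abs_weight) (use B2[of "Suc n" y] B3[of y n] K in auto)
  obtain k \<alpha> \<beta> where k: "strict_mono (k :: nat \<Rightarrow> nat)"
    and lA: "\<And>x. (\<lambda>n. A (Suc (k n)) x) \<longlonglongrightarrow> \<alpha> x" and lB: "\<And>y. (\<lambda>n. B (Suc (k n)) y) \<longlonglongrightarrow> \<beta> y"
    using absA absB
    by (rule pointwise_bounded_convergent_subseq2[of "\<lambda>n. A (Suc n)" _ "\<lambda>n. B (Suc n)"]) (rule that)
  note conv = pmf_conv_const[OF R(1)] pmf_conv_const[OF R(2)] pmf_conv_const[OF S(1)] pmf_conv_const[OF S(2)]
  note DA = pmf_conv_integral[where f' = "\<lambda>n. A (Suc (k n))", OF conv(1) abs_weight_nonneg absA lA]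
  note DB = pmf_conv_integral[where f' = "\<lambda>n. B (Suc (k n))", OF conv(3) abs_weight_nonneg absB lB]
  have TA: "(\<lambda>n. ?TY (A (Suc (k n))) y) \<longlonglongrightarrow> ?TY \<alpha> y"
    and e\<alpha>: "integrable (measure_pmf r) (\<lambda>x. exp ((\<alpha> x - c x y) / lam))" for y
    using lam sw.c_ge(1) A2 lA conv(2) by (rule transform_tendsto)+
  have \<beta>: "\<beta> y = ?TY \<alpha> y" for y
    using LIMSEQ_unique[OF lB[of y]] TA[of y] by (simp add: B_def)
  \<comment> \<open>The solution will be \<open>(\<alpha>', \<beta>)\<close>:
    \<open>\<alpha>'\<close> satisfies its equation everywhere by definition, whereas
    \<open>\<alpha>\<close> is shown to agree with it on the support of \<open>r\<close> only. The
    equation for \<open>\<beta>\<close> sees only that support.\<close>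
  define \<alpha>' where "\<alpha>' = ?TX \<beta>"
  have TB: "(\<lambda>n. A (Suc (Suc (k n))) x) \<longlonglongrightarrow> \<alpha>' x"
    and e\<beta>: "integrable (measure_pmf s) (\<lambda>y. exp ((\<beta> y - c x y) / lam))" for x
    unfolding AS[of "Suc (k _)"] \<alpha>'_def using lam c_ge(1) B1 lB conv(4) by (rule transform_tendsto)+
  note DA' = pmf_conv_integral[where f' = "\<lambda>n. A (Suc (Suc (k n)))", OF conv(1) abs_weight_nonneg absA TB]
  \<comment> \<open>The means of consecutive iterates are consecutive terms of the convergent
    sequence \<open>a\<close>, so both limits have mean \<open>L\<close>.\<close>
  have "(\<lambda>n. a (Suc (k n))) \<longlonglongrightarrow> L"
    using LIMSEQ_subseq_LIMSEQ[OF LIMSEQ_Suc[OF L] k] by (simp add: o_def)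
  then have m1: "?Er \<alpha> = L"
    using DA(1) LIMSEQ_unique unfolding a_def by blast
  have "(\<lambda>n. a (Suc (Suc (k n)))) \<longlonglongrightarrow> L"
    using LIMSEQ_subseq_LIMSEQ[OF LIMSEQ_Suc[OF LIMSEQ_Suc[OF L]] k] by (simp add: o_def)
  then have m2: "?Er \<alpha>' = L"
    using DA'(1) LIMSEQ_unique unfolding a_def by blast
  have eq: "\<alpha> x = \<alpha>' x" if "x \<in> set_pmf r" for x
    using sinkhorn_step_mean(2)[where c = c, OF lam e\<alpha> \<beta> e\<beta> _ DA(2) DA'(2) _ that] m1 m2
    by (simp add: \<alpha>'_def)
  have e\<alpha>': "integrable (measure_pmf r) (\<lambda>x. exp ((\<alpha>' x - c x y) / lam))" for y
    using e\<alpha>[of y] by (subst integrable_cong_AE[where g = "\<lambda>x. exp ((\<alpha> x - c x y) / lam)"])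
      (auto simp: AE_measure_pmf_iff eq)
  have \<beta>': "\<beta> y = ?TY \<alpha>' y" for y
    unfolding \<beta> by (rule entropic_transform_cong) (rule eq)
  have "schrodinger lam c r s \<alpha>' \<beta>"
    unfolding schrodinger_iff_transform[OF lam]
    by (intro conjI allI DA'(2) DB(2) e\<beta> e\<alpha>' \<beta>') (simp add: \<alpha>'_def)
  then show ?thesis
    by blast
qed

end

subsection \<open>Stability of potentials\<close>

definition admissible_conv ::
    "real \<Rightarrow> ('a \<Rightarrow> real) \<Rightarrow> ('a \<Rightarrow> real) \<Rightarrow> ('a \<Rightarrow> real) \<Rightarrow> ('a \<Rightarrow> real)
      \<Rightarrow> (nat \<Rightarrow> 'a pmf) \<Rightarrow> 'a pmf \<Rightarrow> bool" where
  "admissible_conv lam cm cp cm' cp' R r \<longleftrightarrow> pmf_conv (abs_weight cm cp) R r \<and>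
     pmf_conv (abs_weight cm' cp') R r \<and> pmf_conv (exp_weight lam cm' cp') R r"

lemma admissible_convD:
  assumes "admissible_conv lam cm cp cm' cp' R r"
  shows "pmf_conv (abs_weight cm cp) R r" "pmf_conv (abs_weight cm' cp') R r" "pmf_conv (exp_weight lam cm' cp') R r"
    and "admissible lam cm cp cm' cp' r" and "admissible lam cm cp cm' cp' (R n)"
  using assms unfolding admissible_conv_def admissible_def pmf_conv_def by blast+

lemma admissible_conv_const: "admissible lam cm cp cm' cp' r \<Longrightarrow> admissible_conv lam cm cp cm' cp' (\<lambda>_. r) r"
  by (simp add: admissible_conv_def admissible_def pmf_conv_const)

lemma admissible_conv_subseq:
  "admissible_conv lam cm cp cm' cp' R r \<Longrightarrow> strict_mono k \<Longrightarrow> admissible_conv lam cm cp cm' cp' (R \<circ> k) r"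
  unfolding admissible_conv_def using pmf_conv_subseq by blast

lemma pmf_conv_abs_weight_integral:
  fixes cm cp :: "'a::countable \<Rightarrow> real"
  assumes "pmf_conv (abs_weight cm cp) R r"
  shows "(\<lambda>n. measure_pmf.expectation (R n) cm) \<longlonglongrightarrow> measure_pmf.expectation r cm"
    and "(\<lambda>n. measure_pmf.expectation (R n) cp) \<longlonglongrightarrow> measure_pmf.expectation r cp"
  by (rule pmf_conv_integral(1)[OF assms abs_weight_nonneg, where K = 1]; simp add: abs_weight_ge)+

context erot_cost
begin

abbreviation "convX \<equiv> admissible_conv lam cXm cXp cXm' cXp'"
abbreviation "convY \<equiv> admissible_conv lam cYm' cYp' cYm cYp"

text \<open>The dual problem is tested with \<open>cXm\<close> and \<open>cYm\<close>, whose kernel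
  is at most one, so the penalty term can only help. Once the mean of \<alpha> is fixed, this bounds
  the mean of \<beta> from below, as the upper bounds on \<alpha> require.\<close>

lemma schrodinger_value_ge:
  assumes r: "admX r" and s: "admY s" and sol: "schrodinger lam c r s \<alpha> \<beta>"
  shows "measure_pmf.expectation r cXm + measure_pmf.expectation s cYm
      \<le> measure_pmf.expectation r \<alpha> + measure_pmf.expectation s \<beta>"
proof -
  let ?g = "\<lambda>(x, y). gibbs lam c cXm cYm x y"
  have le: "?g z \<le> 1" for z
    using c_ge(1) lam by (auto simp: gibbs_def divide_le_0_iff split: prod.split)
  have i: "integrable (measure_pmf (pair_pmf r s)) ?g"
    by (rule integrable_pmf_bound[where g = "\<lambda>_. 1"]) (use le in \<open>auto simp: gibbs_def\<close>)
  have "measure_pmf.expectation (pair_pmf r s) ?g \<le> measure_pmf.expectation (pair_pmf r s) (\<lambda>_. 1)"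
    using i le by (intro integral_mono) auto
  then have "lam * (measure_pmf.expectation (pair_pmf r s) ?g - 1) \<le> 0"
    using lam by (simp add: mult_le_0_iff)
  then show ?thesis
    using dual_gap(1)[OF lam sol admissibleD(3)[OF r] admissibleD(5)[OF s] i] by simp
qed

text \<open>Besides \<open>m\<close>, the constants involve only means of the dominating functions
  and of the exponential weights, so they stay bounded for convergent marginals. The means give four
  upper bounds by Jensen's inequality; \<open>\<beta> \<le> cYp + K\<close> and
  \<open>\<alpha> \<le> cXp' + K\<close> then give the lower bounds, which lose a second
  \<open>K\<close>.\<close>

lemma schrodinger_bounds:
  assumes r: "admX r" and s: "admY s" and sol: "schrodinger lam c r s \<alpha> \<beta>"
  defines "m \<equiv> measure_pmf.expectation r \<alpha>"
    and "V \<equiv> measure_pmf.expectation r cXm + measure_pmf.expectation s cYm"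
  assumes K: "0 \<le> K" "measure_pmf.expectation r cXp - m \<le> K" "measure_pmf.expectation r cXp' - m \<le> K"
    "measure_pmf.expectation s cYp + m - V \<le> K" "measure_pmf.expectation s cYp' + m - V \<le> K"
    "lam * ln (measure_pmf.expectation s (exp_weight lam cYm cYp)) \<le> K"
    "lam * ln (measure_pmf.expectation r (exp_weight lam cXm' cXp')) \<le> K"
  shows "\<alpha> x \<le> cXp' x + K" "\<beta> y \<le> cYp y + K"
    and "\<bar>\<alpha> x\<bar> \<le> (1 + 2 * K) * abs_weight cXm cXp x"
    and "\<bar>\<beta> y\<bar> \<le> (1 + 2 * K) * abs_weight cYm' cYp' y"
proof -
  note R = admissibleD[OF r] and S = admissibleD[OF s] and D = schrodingerD[OF sol]
  note T = schrodinger_transform[OF lam sol]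
  have V: "V - m \<le> measure_pmf.expectation s \<beta>"
    using schrodinger_value_ge[OF r s sol] by (simp add: V_def m_def)
  have eb: "integrable (measure_pmf s) (\<lambda>y. exp ((\<beta> y - c x y) / lam))" for x
    using D(3)[of x] unfolding gibbs_integrable_iff .
  have ea: "integrable (measure_pmf r) (\<lambda>x. exp ((\<alpha> x - c x y) / lam))" for y
    using schrodingerD(3)[OF schrodinger_swap[OF sol], of y] unfolding gibbs_integrable_iff .
  have "\<alpha> x \<le> cXp x + measure_pmf.expectation s cYp - measure_pmf.expectation s \<beta>" for x
    unfolding T(1)[of x, symmetric] using lam c_le(1) eb D(2) S(6) by (rule transform_upper)
  then have a1: "\<alpha> x \<le> cXp x + K" for x
    using V K(4) by (smt (verit))
  have "\<alpha> x \<le> cXp' x + measure_pmf.expectation s cYp' - measure_pmf.expectation s \<beta>" for x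
    unfolding T(1)[of x, symmetric] using lam c_le(2) eb D(2) S(4) by (rule transform_upper)
  then have a2: "\<alpha> x \<le> cXp' x + K" for x
    using V K(5) by (smt (verit))
  have dom1: "c x y \<le> cYp y + cXp x" "c x y \<le> cYp' y + cXp' x" "cYm' y + cXm' x \<le> c x y" for x y
    using c_le[of x y] c_ge[of x y] by simp_all
  have "\<beta> y \<le> cYp y + measure_pmf.expectation r cXp - measure_pmf.expectation r \<alpha>" for y
    unfolding T(2)[of y, symmetric] using lam dom1(1) ea D(1) R(4) by (rule transform_upper)
  then have b1: "\<beta> y \<le> cYp y + K" for y
    using K(2) unfolding m_def by (smt (verit))
  have "\<beta> y \<le> cYp' y + measure_pmf.expectation r cXp' - measure_pmf.expectation r \<alpha>" for y
    unfolding T(2)[of y, symmetric] using lam dom1(2) ea D(1) R(6) by (rule transform_upper)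
  then have b2: "\<beta> y \<le> cYp' y + K" for y
    using K(3) unfolding m_def by (smt (verit))
  have "cXm x - K - lam * ln (measure_pmf.expectation s (exp_weight lam cYm cYp)) \<le> \<alpha> x" for x
    unfolding T(1)[of x, symmetric] using lam c_ge(1) b1 S(2) by (rule transform_lower)
  then have a3: "cXm x - 2 * K \<le> \<alpha> x" for x
    using K(6) by (smt (verit))
  have "cYm' y - K - lam * ln (measure_pmf.expectation r (exp_weight lam cXm' cXp')) \<le> \<beta> y" for y
    unfolding T(2)[of y, symmetric] using lam dom1(3) a2 R(2) by (rule transform_lower)
  then have b3: "cYm' y - 2 * K \<le> \<beta> y" for y
    using K(7) by (smt (verit))
  show "\<alpha> x \<le> cXp' x + K" "\<beta> y \<le> cYp y + K"
    by (rule a2, rule b1)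
  show "\<bar>\<alpha> x\<bar> \<le> (1 + 2 * K) * abs_weight cXm cXp x"
    by (rule abs_le_abs_weight) (use a1[of x] a3[of x] K(1) in auto)
  show "\<bar>\<beta> y\<bar> \<le> (1 + 2 * K) * abs_weight cYm' cYp' y"
    by (rule abs_le_abs_weight) (use b2[of y] b3[of y] K(1) in auto)
qed

text \<open>Every subsequence has a further one whose pointwise limit solves the system for
  \<open>(r, s)\<close>. Solutions differ by a shift, and the prescribed mean of the first
  potential, which passes to the limit, forces that shift to be zero.\<close>

lemma schrodinger_stable:
  assumes R: "convX R r" and S: "convY S s"
    and soln: "\<And>n. schrodinger lam c (R n) (S n) (\<alpha>' n) (\<beta>' n)"
    and mn: "\<And>n. measure_pmf.expectation (R n) (\<alpha>' n) = measure_pmf.expectation r \<alpha>"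
    and sol: "schrodinger lam c r s \<alpha> \<beta>"
  shows "\<exists>K\<ge>0. \<forall>n. (\<forall>x. \<bar>\<alpha>' n x\<bar> \<le> K * abs_weight cXm cXp x) \<and> (\<forall>y. \<bar>\<beta>' n y\<bar> \<le> K * abs_weight cYm' cYp' y)"
    and "(\<lambda>n. \<alpha>' n x) \<longlonglongrightarrow> \<alpha> x" and "(\<lambda>n. \<beta>' n y) \<longlonglongrightarrow> \<beta> y"
proof -
  interpret sw: erot_cost lam "\<lambda>y x. c x y" cYm' cYp' cXm' cXp' cYm cYp cXm cXp
    by (rule swap)
  let ?m = "measure_pmf.expectation r \<alpha>"
  note RD = admissible_convD[OF R] and SD = admissible_convD[OF S]
  note RX = pmf_conv_abs_weight_integral[OF RD(1)] pmf_conv_abs_weight_integral[OF RD(2)]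
    and SY = pmf_conv_abs_weight_integral[OF SD(1)] pmf_conv_abs_weight_integral[OF SD(2)]
  let ?V = "\<lambda>n. measure_pmf.expectation (R n) cXm + measure_pmf.expectation (S n) cYm"
  have pos: "0 < measure_pmf.expectation s (exp_weight lam cYm cYp)"
    "0 < measure_pmf.expectation r (exp_weight lam cXm' cXp')"
    using admissibleD(2)[OF SD(4)] admissibleD(2)[OF RD(4)]
    by (auto intro!: integral_pmf_pos simp: exp_weight_def)
  \<comment> \<open>Convergent sequences of means are bounded, which makes each constant of
    \<open>schrodinger_bounds\<close> uniform in \<open>n\<close>.\<close>
  obtain K1 where K1: "measure_pmf.expectation (R n) cXp - ?m \<le> K1" for n
    using LIMSEQ_bdd_above[OF tendsto_diff[OF RX(2) tendsto_const[of ?m]]] by blast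
  obtain K2 where K2: "measure_pmf.expectation (R n) cXp' - ?m \<le> K2" for n
    using LIMSEQ_bdd_above[OF tendsto_diff[OF RX(4) tendsto_const[of ?m]]] by blast
  note V = tendsto_add[OF RX(1) SY(3)]
  obtain K3 where K3: "measure_pmf.expectation (S n) cYp + ?m - ?V n \<le> K3" for n
    using LIMSEQ_bdd_above[OF tendsto_diff[OF tendsto_add[OF SY(4) tendsto_const[of ?m]] V]] by blast
  obtain K4 where K4: "measure_pmf.expectation (S n) cYp' + ?m - ?V n \<le> K4" for n
    using LIMSEQ_bdd_above[OF tendsto_diff[OF tendsto_add[OF SY(2) tendsto_const[of ?m]] V]] by blast
  have "(\<lambda>n. lam * ln (measure_pmf.expectation (S n) (exp_weight lam cYm cYp)))
      \<longlonglongrightarrow> lam * ln (measure_pmf.expectation s (exp_weight lam cYm cYp))"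
    using SD(3) pos by (intro tendsto_intros) (auto simp: pmf_conv_def)
  then obtain K5 where K5: "lam * ln (measure_pmf.expectation (S n) (exp_weight lam cYm cYp)) \<le> K5" for n
    using LIMSEQ_bdd_above by blast
  have "(\<lambda>n. lam * ln (measure_pmf.expectation (R n) (exp_weight lam cXm' cXp')))
      \<longlonglongrightarrow> lam * ln (measure_pmf.expectation r (exp_weight lam cXm' cXp'))"
    using RD(3) pos by (intro tendsto_intros) (auto simp: pmf_conv_def)
  then obtain K6 where K6: "lam * ln (measure_pmf.expectation (R n) (exp_weight lam cXm' cXp')) \<le> K6" for n
    using LIMSEQ_bdd_above by blast
  define K where "K = \<bar>K1\<bar> + \<bar>K2\<bar> + \<bar>K3\<bar> + \<bar>K4\<bar> + \<bar>K5\<bar> + \<bar>K6\<bar>"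
  have K: "0 \<le> K" "K1 \<le> K" "K2 \<le> K" "K3 \<le> K" "K4 \<le> K" "K5 \<le> K" "K6 \<le> K"
    by (auto simp: K_def)
  note bounds = schrodinger_bounds[OF RD(5) SD(5) soln K(1), unfolded mn,
      OF order_trans[OF K1 K(2)] order_trans[OF K2 K(3)] order_trans[OF K3 K(4)]
        order_trans[OF K4 K(5)] order_trans[OF K5 K(6)] order_trans[OF K6 K(7)]]
  show "\<exists>K\<ge>0. \<forall>n. (\<forall>x. \<bar>\<alpha>' n x\<bar> \<le> K * abs_weight cXm cXp x) \<and> (\<forall>y. \<bar>\<beta>' n y\<bar> \<le> K * abs_weight cYm' cYp' y)"
    using bounds(3,4) K(1) by (intro exI[of _ "1 + 2 * K"]) auto
  have sub: "\<exists>k'. (\<forall>x. (\<lambda>n. \<alpha>' (k (k' n)) x) \<longlonglongrightarrow> \<alpha> x) \<and> (\<forall>y. (\<lambda>n. \<beta>' (k (k' n)) y) \<longlonglongrightarrow> \<beta> y)"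
    if k: "strict_mono k" for k :: "nat \<Rightarrow> nat"
  proof -
    obtain k' a b where k': "strict_mono (k' :: nat \<Rightarrow> nat)"
      and la: "\<And>x. (\<lambda>n. \<alpha>' (k (k' n)) x) \<longlonglongrightarrow> a x" and lb: "\<And>y. (\<lambda>n. \<beta>' (k (k' n)) y) \<longlonglongrightarrow> b y"
      using bounds(3,4)
      by (rule pointwise_bounded_convergent_subseq2[of "\<lambda>n. \<alpha>' (k n)" _ "\<lambda>n. \<beta>' (k n)"]) (rule that)
    let ?k = "k \<circ> k'"
    have kk: "strict_mono ?k"
      using k k' by (rule strict_mono_o)
    note R' = admissible_convD[OF admissible_conv_subseq[OF R kk], unfolded o_def]
      and S' = admissible_convD[OF admissible_conv_subseq[OF S kk], unfolded o_def]
    note Ia = pmf_conv_integral[where f' = "\<lambda>n. \<alpha>' (k (k' n))", OF R'(1) abs_weight_nonneg bounds(3) la]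
    note Ib = pmf_conv_integral[where f' = "\<lambda>n. \<beta>' (k (k' n))", OF S'(1) abs_weight_nonneg bounds(4) lb]
    have dom1: "cYm' y + cXm' x \<le> c x y" for x y
      using c_ge[of x y] by simp
    have Ta: "(\<lambda>n. entropic_transform lam (\<lambda>y x. c x y) (R (k (k' n))) (\<alpha>' (k (k' n))) y)
        \<longlonglongrightarrow> entropic_transform lam (\<lambda>y x. c x y) r a y"
      and ea: "integrable (measure_pmf r) (\<lambda>x. exp ((a x - c x y) / lam))" for y
      using lam dom1 bounds(1) la R'(3) by (rule transform_tendsto)+
    have Tb: "(\<lambda>n. entropic_transform lam c (S (k (k' n))) (\<beta>' (k (k' n))) x)
        \<longlonglongrightarrow> entropic_transform lam c s b x"
      and eb: "integrable (measure_pmf s) (\<lambda>y. exp ((b y - c x y) / lam))" for x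
      using lam c_ge(1) bounds(2) lb S'(3) by (rule transform_tendsto)+
    have a: "a x = entropic_transform lam c s b x" for x
      by (rule LIMSEQ_unique[OF la Tb[unfolded schrodinger_transform(1)[OF lam soln]]])
    have b: "b y = entropic_transform lam (\<lambda>y x. c x y) r a y" for y
      by (rule LIMSEQ_unique[OF lb Ta[unfolded schrodinger_transform(2)[OF lam soln]]])
    have sol': "schrodinger lam c r s a b"
      unfolding schrodinger_iff_transform[OF lam]
      by (intro conjI allI Ia(2) Ib(2) ea eb) (rule a, rule b)
    obtain \<eta> where \<eta>: "a = (\<lambda>x. \<alpha> x + \<eta>)" "b = (\<lambda>y. \<beta> y - \<eta>)"
      by (rule EROT_potentials_unique[OF lam sol schrodinger_EROT_potentials[OF lam sol']])
    have "measure_pmf.expectation r a = ?m"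
      using Ia(1) unfolding mn by (simp add: LIMSEQ_const_iff)
    then have "\<eta> = 0"
      using schrodingerD(1)[OF sol] by (simp add: \<eta>)
    then show ?thesis
      using la lb \<eta> by (intro exI[of _ k']) simp
  qed
  show "(\<lambda>n. \<alpha>' n x) \<longlonglongrightarrow> \<alpha> x"
    using sub by (intro tendsto_subsubseqI) blast
  show "(\<lambda>n. \<beta>' n y) \<longlonglongrightarrow> \<beta> y"
    using sub by (intro tendsto_subsubseqI) blast
qed

end

subsection \<open>Difference quotients of functionals and of the optimal value\<close>

lemma pairing_eq_integral: "pairing f a = (\<integral>x. f x * a x \<partial>count_space UNIV)"
  by (simp add: pairing_def integral_count_space_eq_infsum)

lemma mem_ell1_iff: "a \<in> ell1 w \<longleftrightarrow> integrable (count_space UNIV) (\<lambda>x. w x * \<bar>a x\<bar>)"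
  by (simp add: ell1_def integrable_count_space_iff_summable_on)

lemma integrable_mult_ell1:
  assumes "a \<in> ell1 w" "\<And>x. \<bar>f x\<bar> \<le> w x"
  shows "integrable (count_space UNIV) (\<lambda>x. f x * a x)"
  by (rule Bochner_Integration.integrable_bound[OF assms(1)[unfolded mem_ell1_iff]])
    (auto simp: abs_mult intro!: mult_mono order_trans[OF assms(2) abs_ge_self])

lemma pairing_tendsto:
  fixes a :: "'a \<Rightarrow> real"
  assumes a: "a \<in> ell1 C" and bd: "\<And>n x. \<bar>g' n x\<bar> \<le> K * C x" and lim: "\<And>x. (\<lambda>n. g' n x) \<longlonglongrightarrow> g x"
  shows "(\<lambda>n. pairing (g' n) a) \<longlonglongrightarrow> pairing g a"
  unfolding pairing_eq_integral
proof (rule integral_dominated_convergence)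
  show "integrable (count_space UNIV) (\<lambda>x. K * (C x * \<bar>a x\<bar>))"
    using a by (simp add: mem_ell1_iff)
  show "AE x in count_space UNIV. norm (g' n x * a x) \<le> K * (C x * \<bar>a x\<bar>)" for n
    using mult_right_mono[OF bd abs_ge_zero] by (simp add: abs_mult mult.assoc)
  show "AE x in count_space UNIV. (\<lambda>n. g' n x * a x) \<longlonglongrightarrow> g x * a x"
    by (intro AE_I2 tendsto_intros lim)
qed auto

lemma pairing_indicator: "pairing (indicator {x}) a = a x"
proof -
  have "pairing (indicator {x}) a = (\<Sum>\<^sub>\<infinity>z\<in>{x}. a z)"
    unfolding pairing_def by (rule infsum_cong_neutral) auto
  then show ?thesis
    by simp
qed

lemma tendsto_apply_bcontfun:
  fixes h :: "'a::topological_space \<Rightarrow>\<^sub>C 'b::metric_space"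
  assumes "H \<longlonglongrightarrow> h"
  shows "(\<lambda>n. apply_bcontfun (H n) x) \<longlonglongrightarrow> apply_bcontfun h x"
proof (rule tendsto_dist_iff[THEN iffD2], rule tendsto_sandwich[OF _ _ tendsto_const])
  show "(\<lambda>n. dist (H n) h) \<longlonglongrightarrow> 0"
    using assms by (simp add: tendsto_dist_iff[symmetric])
qed (auto simp: dist_bounded)

text \<open>
  The representing measure is read off from the values of \<open>h\<close> at the indicators of points; its
  \<open>ell1\<close> bounds come from testing with \<open>C z * sgn (v z)\<close> on finite sets.
\<close>

lemma functional_quotient:
  fixes h :: "'a::countable functional"
  assumes F: "{f. \<forall>z. \<bar>f z\<bar> \<le> C z} \<subseteq> F" and C: "\<And>z. 1 \<le> C z"
    and r: "r \<in> prob_linf F" and R: "\<And>n. R n \<in> prob_linf F"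
    and lim: "(\<lambda>n. (as_functional F (R n) - as_functional F r) /\<^sub>R t n) \<longlonglongrightarrow> h"
  shows "signed_measure C h \<in> ell1 C"
    and "(\<And>z. \<bar>f z\<bar> \<le> C z) \<Longrightarrow> apply_bcontfun h (discrete f) = pairing f (signed_measure C h)"
    and "\<lbrakk>\<And>n z. \<bar>g' n z\<bar> \<le> K * C z; \<And>z. (\<lambda>n. g' n z) \<longlonglongrightarrow> g z; 0 \<le> K\<rbrakk> \<Longrightarrow>
      (\<lambda>n. (measure_pmf.expectation (R n) (g' n) - measure_pmf.expectation r (g' n)) /\<^sub>R t n)
        \<longlonglongrightarrow> pairing g (signed_measure C h)"
proof -
  let ?M = "count_space (UNIV :: 'a set)"
  define H where "H = (\<lambda>n. (as_functional F (R n) - as_functional F r) /\<^sub>R t n)"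
  have H: "H \<longlonglongrightarrow> h"
    using lim by (simp add: H_def)
  have C0: "0 \<le> C z" for z
    using C[of z] by simp
  have int: "integrable (measure_pmf r) f" "integrable (measure_pmf (R n)) f" if "f \<in> F" for f n
    using r R that unfolding prob_linf_def mem_ell1_pmf[symmetric] by blast+
  have Hf: "apply_bcontfun (H n) (discrete f) = (measure_pmf.expectation (R n) f - measure_pmf.expectation r f) /\<^sub>R t n"
    if "\<And>z. \<bar>f z\<bar> \<le> C z" for f n
    using F that by (simp add: H_def apply_as_functional[OF r] apply_as_functional[OF R] pairing_pmf subset_eq)
  define b where "b = (\<lambda>n x. (pmf (R n) x - pmf r x) /\<^sub>R t n)"
  have Hfin: "apply_bcontfun (H n) (discrete (\<lambda>z. f z * indicator X z)) = (\<Sum>x\<in>X. f x * b n x)"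
    if "\<And>z. \<bar>f z\<bar> \<le> C z" "finite X" for f n X
  proof -
    have "\<bar>f z * indicator X z\<bar> \<le> C z" for z
      using that(1)[of z] C0[of z] by (simp add: indicator_def)
    moreover have "measure_pmf.expectation p (\<lambda>z. f z * indicator X z) = (\<Sum>x\<in>X. f x * pmf p x)" for p
      using that(2) by (subst integral_measure_pmf_real[of X]) (auto split: split_indicator_asm)
    ultimately show ?thesis
      by (simp add: Hf b_def sum_subtractf[symmetric] scaleR_sum_right right_diff_distrib mult.left_commute
          sum_distrib_left)
  qed
  define a where "a = (\<lambda>x. apply_bcontfun h (discrete (indicator {x})))"
  have ind: "\<bar>indicator {x} z\<bar> \<le> C z" for x z
    using C[of z] by (auto simp: indicator_def)
  have "apply_bcontfun (H n) (discrete (indicator {x})) = b n x" for n x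
  proof -
    have "(\<lambda>z. indicator {x} z * indicator {x} z) = (indicator {x} :: 'a \<Rightarrow> real)"
      by (auto simp: indicator_def)
    then show ?thesis
      using Hfin[of "indicator {x}" "{x}" n, OF ind] by simp
  qed
  then have ba: "(\<lambda>n. b n x) \<longlonglongrightarrow> a x" for x
    using tendsto_apply_bcontfun[OF H, of "discrete (indicator {x})"] by (simp add: a_def)
  have hfin: "apply_bcontfun h (discrete (\<lambda>z. f z * indicator X z)) = (\<Sum>x\<in>X. f x * a x)"
    if "\<And>z. \<bar>f z\<bar> \<le> C z" "finite X" for f X
  proof (rule LIMSEQ_unique)
    show "(\<lambda>n. apply_bcontfun (H n) (discrete (\<lambda>z. f z * indicator X z)))
        \<longlonglongrightarrow> apply_bcontfun h (discrete (\<lambda>z. f z * indicator X z))"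
      by (rule tendsto_apply_bcontfun[OF H])
    show "(\<lambda>n. apply_bcontfun (H n) (discrete (\<lambda>z. f z * indicator X z))) \<longlonglongrightarrow> (\<Sum>x\<in>X. f x * a x)"
      unfolding Hfin[OF that] by (intro tendsto_intros ba)
  qed
  have sgnC: "\<bar>C z * sgn (v z)\<bar> \<le> C z" for v :: "'a \<Rightarrow> real" and z
    using C0[of z] by (simp add: abs_mult sgn_if)
  have sgn_mult: "C z * sgn v * v = C z * \<bar>v\<bar>" for z and v :: real
    by (simp add: abs_sgn mult_ac)
  have fin_a: "(\<Sum>x\<in>X. C x * \<bar>a x\<bar>) \<le> norm h" if "finite X" for X
    using hfin[of "\<lambda>z. C z * sgn (a z)", OF sgnC[where v = a] that]
      norm_bounded[of h "discrete (\<lambda>z. C z * sgn (a z) * indicator X z)"]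
    by (simp add: sgn_mult)
  have a: "a \<in> ell1 C"
    unfolding ell1_def mem_Collect_eq
    by (rule nonneg_bdd_above_summable_on) (use C0 fin_a in \<open>auto intro!: bdd_aboveI2\<close>)
  \<comment> \<open>The same sign test, applied to \<open>H n - h\<close>, bounds the weighted
    \<open>ell1\<close> distance between \<open>b n\<close> and \<open>a\<close> by the supremum
    norm.\<close>
  have fin_ba: "(\<Sum>x\<in>X. C x * \<bar>b n x - a x\<bar>) \<le> norm (H n - h)" if "finite X" for X n
    using hfin[of "\<lambda>z. C z * sgn (b n z - a z)", OF sgnC[where v = "\<lambda>z. b n z - a z"] that]
      Hfin[of "\<lambda>z. C z * sgn (b n z - a z)", OF sgnC[where v = "\<lambda>z. b n z - a z"] that, of n]
      norm_bounded[of "H n - h" "discrete (\<lambda>z. C z * sgn (b n z - a z) * indicator X z)"]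
    by (simp add: sgn_mult flip: sum_subtractf right_diff_distrib)
  have sba: "(\<lambda>x. C x * \<bar>b n x - a x\<bar>) summable_on UNIV" for n
    by (rule nonneg_bdd_above_summable_on) (use C0 fin_ba in \<open>auto intro!: bdd_aboveI2\<close>)
  have iba: "(\<integral>x. C x * \<bar>b n x - a x\<bar> \<partial>?M) \<le> norm (H n - h)" for n
    unfolding integral_count_space_eq_infsum using sba fin_ba by (rule infsum_le_finite_sums)
  have hf: "apply_bcontfun h (discrete f) = pairing f a" if f: "\<And>z. \<bar>f z\<bar> \<le> C z" for f
  proof (rule LIMSEQ_unique)
    show "(\<lambda>n. apply_bcontfun (H n) (discrete f)) \<longlonglongrightarrow> apply_bcontfun h (discrete f)"
      by (rule tendsto_apply_bcontfun[OF H])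
    have fF: "f \<in> F"
      using F f by blast
    have fa: "integrable ?M (\<lambda>x. f x * a x)"
      by (rule integrable_mult_ell1[OF a f])
    have fba: "integrable ?M (\<lambda>x. C x * \<bar>b n x - a x\<bar>)" for n
      using sba by (simp add: integrable_count_space_iff_summable_on)
    have fb: "(\<lambda>x. f x * b n x) = (\<lambda>x. inverse (t n) * (f x * pmf (R n) x - f x * pmf r x))" for n
      by (simp add: b_def right_diff_distrib mult.left_commute)
    have "apply_bcontfun (H n) (discrete f) = (\<integral>x. f x * b n x \<partial>?M)" for n
      using int[OF fF] unfolding Hf[OF f] fb integral_pmf_eq_count_space integrable_pmf_iff_count_space
      by simp
    moreover have "integrable ?M (\<lambda>x. f x * b n x)" for n
      using int[OF fF] unfolding fb integrable_pmf_iff_count_space by (intro integrable_mult_right) auto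
    ultimately have diff: "apply_bcontfun (H n) (discrete f) - pairing f a = (\<integral>x. f x * b n x - f x * a x \<partial>?M)"
      and idiff: "integrable ?M (\<lambda>x. f x * b n x - f x * a x)" for n
      using fa by (simp_all add: pairing_eq_integral)
    have bound: "norm (apply_bcontfun (H n) (discrete f) - pairing f a) \<le> norm (H n - h)" for n
    proof -
      have "norm (apply_bcontfun (H n) (discrete f) - pairing f a) \<le> (\<integral>x. C x * \<bar>b n x - a x\<bar> \<partial>?M)"
        unfolding diff
      proof (rule order_trans[OF integral_norm_bound integral_mono])
        show "norm (f x * b n x - f x * a x) \<le> C x * \<bar>b n x - a x\<bar>" for x
          using mult_right_mono[OF f abs_ge_zero, of x "b n x - a x"]
          by (simp add: abs_mult flip: right_diff_distrib)
      qed (use idiff fba in auto)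
      then show ?thesis
        using iba[of n] by simp
    qed
    have "(\<lambda>n. apply_bcontfun (H n) (discrete f) - pairing f a) \<longlonglongrightarrow> 0"
    proof (rule Lim_null_comparison)
      show "(\<lambda>n. norm (H n - h)) \<longlonglongrightarrow> 0"
        using H by (simp add: tendsto_norm_zero LIM_zero)
    qed (use bound in simp)
    then show "(\<lambda>n. apply_bcontfun (H n) (discrete f)) \<longlonglongrightarrow> pairing f a"
      by (rule LIM_zero_cancel)
  qed
  have sm: "signed_measure C h = a"
    unfolding signed_measure_def
  proof (rule the_equality)
    fix a' assume a': "a' \<in> ell1 C \<and> (\<forall>f. (\<forall>z. \<bar>f z\<bar> \<le> C z) \<longrightarrow> apply_bcontfun h (discrete f) = pairing f a')"
    show "a' = a"
    proof
      fix x
      have "apply_bcontfun h (discrete (indicator {x})) = pairing (indicator {x}) a'"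
        using a' ind by blast
      then show "a' x = a x"
        by (simp add: a_def pairing_indicator)
    qed
  qed (use a hf in blast)
  show "signed_measure C h \<in> ell1 C"
    unfolding sm by (rule a)
  show "apply_bcontfun h (discrete f) = pairing f (signed_measure C h)" if "\<And>z. \<bar>f z\<bar> \<le> C z"
    unfolding sm using that by (rule hf)
  assume bd: "\<And>n z. \<bar>g' n z\<bar> \<le> K * C z" and g: "\<And>z. (\<lambda>n. g' n z) \<longlonglongrightarrow> g z" and K: "0 \<le> K"
  \<comment> \<open>Rescaling puts the test functions into the class bounded by \<open>C\<close>;
    with \<open>K + 1\<close> the divisor is positive even for \<open>K = 0\<close>.\<close>
  define G where "G = (\<lambda>n z. g' n z / (K + 1))"
  have G: "\<bar>G n z\<bar> \<le> C z" for n z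
  proof -
    have "\<bar>g' n z\<bar> \<le> (K + 1) * C z"
      using bd[of n z] C0[of z] by (simp add: distrib_right)
    then show ?thesis
      using K by (simp add: G_def pos_divide_le_eq mult.commute)
  qed
  have "(measure_pmf.expectation (R n) (g' n) - measure_pmf.expectation r (g' n)) /\<^sub>R t n
      = (K + 1) * apply_bcontfun (H n) (discrete (G n))" for n
    unfolding Hf[OF G] using K by (simp add: G_def divide_simps)
  moreover have "(K + 1) * apply_bcontfun h (discrete (G n)) = pairing (g' n) a" for n
    unfolding hf[OF G] using K by (simp add: G_def pairing_eq_integral)
  \<comment> \<open>Norm convergence is uniform over all test functions, so the test function may
    change with \<open>n\<close>.\<close>
  moreover have "(\<lambda>n. apply_bcontfun (H n) (discrete (G n)) - apply_bcontfun h (discrete (G n))) \<longlonglongrightarrow> 0"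
  proof (rule Lim_null_comparison)
    show "(\<lambda>n. norm (H n - h)) \<longlonglongrightarrow> 0"
      using H by (simp add: tendsto_norm_zero LIM_zero)
    show "\<forall>\<^sub>F n in sequentially. norm (apply_bcontfun (H n) (discrete (G n)) - apply_bcontfun h (discrete (G n)))
        \<le> norm (H n - h)"
      using norm_bounded[of "H _ - h" "discrete (G _)"] by simp
  qed
  then have "(\<lambda>n. (K + 1) * (apply_bcontfun (H n) (discrete (G n)) - apply_bcontfun h (discrete (G n)))) \<longlonglongrightarrow> 0"
    by (rule tendsto_mult_right_zero)
  ultimately have "(\<lambda>n. (measure_pmf.expectation (R n) (g' n) - measure_pmf.expectation r (g' n)) /\<^sub>R t n
      - pairing (g' n) a) \<longlonglongrightarrow> 0"
    by (simp add: right_diff_distrib)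
  from tendsto_add[OF this pairing_tendsto[OF a bd g]]
  show "(\<lambda>n. (measure_pmf.expectation (R n) (g' n) - measure_pmf.expectation r (g' n)) /\<^sub>R t n)
        \<longlonglongrightarrow> pairing g (signed_measure C h)"
    by (simp add: sm)
qed

section \<open>Integrability and convergence read off from the function classes\<close>

lemma inj_on_as_functional:
  assumes F: "\<And>x. indicator {x} \<in> F"
  shows "inj_on (as_functional F) (prob_linf F)"
proof (rule inj_onI, rule pmf_eqI)
  fix r r' x assume r: "r \<in> prob_linf F" "r' \<in> prob_linf F" and eq: "as_functional F r = as_functional F r'"
  show "pmf r x = pmf r' x"
    using arg_cong[OF eq, of "\<lambda>h. apply_bcontfun h (discrete (indicator {x}))"] F
    by (simp add: apply_as_functional[OF r(1)] apply_as_functional[OF r(2)] pairing_indicator)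
qed

abbreviation (input) weight_class ::
    "real \<Rightarrow> ('a \<Rightarrow> real) \<Rightarrow> ('a \<Rightarrow> real) \<Rightarrow> ('a \<Rightarrow> real) \<Rightarrow> ('a \<Rightarrow> real) \<Rightarrow> (nat \<Rightarrow> 'a) \<Rightarrow> ('a \<Rightarrow> real) set" where
  "weight_class lam cm cp cm' cp' e \<equiv>
     function_class (abs_weight cm cp) (abs_weight cm' cp') (exp_weight lam cm' cp') e"

lemma weight_class_mem:
  "{f. \<forall>z. \<bar>f z\<bar> \<le> abs_weight cm cp z} \<subseteq> weight_class lam cm cp cm' cp' e"
  "abs_weight cm cp \<in> weight_class lam cm cp cm' cp' e"
  "abs_weight cm' cp' \<in> weight_class lam cm cp cm' cp' e"
  "exp_weight lam cm' cp' \<in> weight_class lam cm cp cm' cp' e"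
  "indicator {x} \<in> weight_class lam cm cp cm' cp' e"
  using abs_weight_nonneg[of cm cp] order_trans[OF _ abs_weight_ge(1)[of cm cp]]
  by (auto simp: function_class_def indicator_def)

text \<open>The sum of the three weights dominates every member of the class, so its mean bounds all
  pairings at once. Conversely, the three weights are members.\<close>

lemma prob_linf_weight_class:
  "r \<in> prob_linf (weight_class lam cm cp cm' cp' e) \<longleftrightarrow> admissible lam cm cp cm' cp' r"
proof
  assume "r \<in> prob_linf (weight_class lam cm cp cm' cp' e)"
  then have "integrable (measure_pmf r) f" if "f \<in> weight_class lam cm cp cm' cp' e" for f
    using that by (auto simp: prob_linf_def mem_ell1_pmf)
  then show "admissible lam cm cp cm' cp' r"
    using weight_class_mem(2,3,4) unfolding admissible_def by blast
next
  assume adm: "admissible lam cm cp cm' cp' r"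
  let ?F = "weight_class lam cm cp cm' cp' e"
  let ?w = "\<lambda>z. abs_weight cm cp z + abs_weight cm' cp' z + exp_weight lam cm' cp' z"
  have w: "integrable (measure_pmf r) ?w"
    using adm by (simp add: admissible_def)
  have le: "\<bar>f z\<bar> \<le> ?w z" if "f \<in> ?F" for f z
    using that abs_weight_nonneg[of cm cp z] abs_weight_nonneg[of cm' cp' z] exp_weight_nonneg[of lam cm' cp' z]
    by (auto simp: function_class_def indicator_def intro: add_increasing2)
  have int: "integrable (measure_pmf r) f" if "f \<in> ?F" for f
    by (rule integrable_pmf_bound[OF w le[OF that]])
  have "\<bar>pairing f (pmf r)\<bar> \<le> measure_pmf.expectation r ?w" if "f \<in> ?F" for f
    unfolding pairing_pmf real_norm_def[symmetric]
    by (rule order_trans[OF integral_norm_bound integral_mono]) (use int w le that in auto)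
  then show "r \<in> prob_linf ?F"
    using int by (auto simp: prob_linf_def mem_ell1_pmf intro!: boundedI)
qed

text \<open>Evaluations are continuous in the supremum norm: those at indicators of points give the
  masses, those at the weights give the means in \<open>pmf_conv\<close>.\<close>

lemma admissible_conv_of_functional:
  assumes r: "r \<in> prob_linf (weight_class lam cm cp cm' cp' e)"
    and R: "\<And>n. R n \<in> prob_linf (weight_class lam cm cp cm' cp' e)"
    and lim: "(\<lambda>n. as_functional (weight_class lam cm cp cm' cp' e) (R n))
      \<longlonglongrightarrow> as_functional (weight_class lam cm cp cm' cp' e) r"
  shows "admissible_conv lam cm cp cm' cp' R r"
proof -
  let ?F = "weight_class lam cm cp cm' cp' e"
  have l: "(\<lambda>n. pairing f (pmf (R n))) \<longlonglongrightarrow> pairing f (pmf r)" if "f \<in> ?F" for f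
    using tendsto_apply_bcontfun[OF lim, of "discrete f"] that
    by (simp add: apply_as_functional[OF r] apply_as_functional[OF R])
  have int: "integrable (measure_pmf r) f" "integrable (measure_pmf (R n)) f" if "f \<in> ?F" for f n
    using r R that unfolding prob_linf_def mem_ell1_pmf[symmetric] by blast+
  have "pmf_conv f R r" if f: "f \<in> ?F" for f
    unfolding pmf_conv_def using int[OF f] l[OF f] l[OF weight_class_mem(5)]
    by (simp add: pairing_pmf[symmetric] pairing_indicator)
  then show ?thesis
    unfolding admissible_conv_def using weight_class_mem(2,3,4) by blast
qed

section \<open>Comparison of optimal values for different marginals\<close>

context erot_cost
begin

lemma schrodinger_bounded:
  assumes r: "admX r" and s: "admY s" and sol: "schrodinger lam c r s \<alpha> \<beta>"
  obtains K where "0 \<le> K" "\<And>x. \<alpha> x \<le> cXp' x + K" "\<And>y. \<beta> y \<le> cYp y + K"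
    "\<And>x. \<bar>\<alpha> x\<bar> \<le> K * abs_weight cXm cXp x" "\<And>y. \<bar>\<beta> y\<bar> \<le> K * abs_weight cYm' cYp' y"
proof -
  define m where "m = measure_pmf.expectation r \<alpha>"
  define V where "V = measure_pmf.expectation r cXm + measure_pmf.expectation s cYm"
  define K where "K = \<bar>measure_pmf.expectation r cXp - m\<bar> + \<bar>measure_pmf.expectation r cXp' - m\<bar>
    + \<bar>measure_pmf.expectation s cYp + m - V\<bar> + \<bar>measure_pmf.expectation s cYp' + m - V\<bar>
    + \<bar>lam * ln (measure_pmf.expectation s (exp_weight lam cYm cYp))\<bar>
    + \<bar>lam * ln (measure_pmf.expectation r (exp_weight lam cXm' cXp'))\<bar>"
  have K: "0 \<le> K" "measure_pmf.expectation r cXp - m \<le> K" "measure_pmf.expectation r cXp' - m \<le> K"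
    "measure_pmf.expectation s cYp + m - V \<le> K" "measure_pmf.expectation s cYp' + m - V \<le> K"
    "lam * ln (measure_pmf.expectation s (exp_weight lam cYm cYp)) \<le> K"
    "lam * ln (measure_pmf.expectation r (exp_weight lam cXm' cXp')) \<le> K"
    unfolding K_def by linarith+
  note b = schrodinger_bounds[OF r s sol K[unfolded m_def V_def]]
  have le: "K \<le> 1 + 2 * K"
    using K(1) by simp
  show thesis
  proof (rule that)
    show "0 \<le> 1 + 2 * K"
      using K(1) by simp
    show "\<alpha> x \<le> cXp' x + (1 + 2 * K)" "\<beta> y \<le> cYp y + (1 + 2 * K)" for x y
      using b(1)[of x] b(2)[of y] le by linarith+
  qed (rule b(3), rule b(4))
qed

text \<open>Potentials of one pair of marginals will be competitors in the dual problem of another.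
  Domination by the norm weights makes them integrable there.\<close>

lemma schrodinger_integrable:
  assumes r: "admX r" "admX r'" and s: "admY s" "admY s'" and sol: "schrodinger lam c r s \<alpha> \<beta>"
  shows "integrable (measure_pmf r') \<alpha>" "integrable (measure_pmf s') \<beta>"
proof -
  obtain K where K: "\<And>x. \<bar>\<alpha> x\<bar> \<le> K * abs_weight cXm cXp x" "\<And>y. \<bar>\<beta> y\<bar> \<le> K * abs_weight cYm' cYp' y"
    using schrodinger_bounded[OF r(1) s(1) sol] by metis
  show "integrable (measure_pmf r') \<alpha>"
    by (rule integrable_pmf_bound[OF _ K(1)]) (use admissibleD(1)[OF r(2)] in simp)
  show "integrable (measure_pmf s') \<beta>"
    by (rule integrable_pmf_bound[OF _ K(2)]) (use admissibleD(1)[OF s(2)] in simp)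
qed

text \<open>
  When only one marginal changes, the old potentials still satisfy one half of the Schrodinger
  system, so the exponential penalty in the dual objective vanishes and no second-order term arises.
\<close>

lemma schrodinger_value_mono:
  assumes r: "admX r" and s: "admY s" and s': "admY s'"
    and sol: "schrodinger lam c r s \<alpha> \<beta>" and sol': "schrodinger lam c r s' \<alpha>' \<beta>'"
  shows "measure_pmf.expectation r \<alpha> + measure_pmf.expectation s' \<beta>
      \<le> measure_pmf.expectation r \<alpha>' + measure_pmf.expectation s' \<beta>'"
proof -
  obtain K where K: "\<And>y. \<beta> y \<le> cYp y + K"
    using schrodinger_bounded[OF r s sol] by metis
  have "integrable (measure_pmf s') (\<lambda>y. exp ((\<beta> y - c x y) / lam))" for x
    using schrodinger_integrable(2)[OF r r s s' sol] K by (rule transform_bounds(1)[OF s'])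
  then have i: "integrable (measure_pmf s') (gibbs lam c \<alpha> \<beta> x)" for x
    unfolding gibbs_integrable_iff .
  note G = pair_pmf_swap_integral[of "gibbs lam c \<alpha> \<beta>", OF gibbs_nonneg schrodingerD(5,6)[OF sol] i]
  show ?thesis
    using dual_gap(1)[OF lam sol' schrodingerD(1)[OF sol] schrodinger_integrable(2)[OF r r s s' sol] G(1)]
    unfolding G(2) by simp
qed

lemma EROT_eq:
  assumes r: "admX r" and s: "admY s" and sol: "schrodinger lam c r s \<alpha> \<beta>"
  shows "EROT lam c r s = measure_pmf.expectation r \<alpha> + measure_pmf.expectation s \<beta>"
proof (rule EROT_schrodinger[OF lam sol])
  show "integrable (measure_pmf r) (abs_weight cXm cXp)" "integrable (measure_pmf s) (abs_weight cYm cYp)"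
    using r s by (auto simp: admissible_def)
  show "\<bar>c x y\<bar> \<le> abs_weight cXm cXp x + abs_weight cYm cYp y" for x y
    using c_le(1)[of x y] c_ge(1)[of x y] by (auto simp: abs_weight_def)
qed

lemma exists_normalized_schrodinger:
  assumes "admX r" "admY s"
  obtains \<alpha> \<beta> where "schrodinger lam c r s \<alpha> \<beta>" "measure_pmf.expectation r \<alpha> = m"
proof -
  obtain \<alpha> \<beta> where sol: "schrodinger lam c r s \<alpha> \<beta>"
    using exists_schrodinger[OF assms] by blast
  let ?\<eta> = "m - measure_pmf.expectation r \<alpha>"
  show thesis
    by (rule that[OF schrodinger_shift[OF sol, of ?\<eta>]]) (simp add: schrodingerD(1)[OF sol])
qed

text \<open>The values are compared along the path from \<open>(r, s)\<close> through
  \<open>(R n, s)\<close> to \<open>(R n, S n)\<close>, each leg of which changes one marginal. All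
  potentials on the path are normalized to the same mean, so that stability applies and both
  one-sided bounds have the same limit.\<close>

lemma EROT_quotient_tendsto:
  assumes sol: "schrodinger lam c r s \<alpha> \<beta>" and t: "\<And>n. 0 < t n"
    and R: "convX R r" and S: "convY S s"
    and a: "\<And>K g' g. \<lbrakk>\<And>n z. \<bar>g' n z\<bar> \<le> K * abs_weight cXm cXp z; \<And>z. (\<lambda>n. g' n z) \<longlonglongrightarrow> g z; 0 \<le> K\<rbrakk> \<Longrightarrow>
      (\<lambda>n. (measure_pmf.expectation (R n) (g' n) - measure_pmf.expectation r (g' n)) /\<^sub>R t n) \<longlonglongrightarrow> pairing g a"
    and b: "\<And>K g' g. \<lbrakk>\<And>n z. \<bar>g' n z\<bar> \<le> K * abs_weight cYm' cYp' z; \<And>z. (\<lambda>n. g' n z) \<longlonglongrightarrow> g z; 0 \<le> K\<rbrakk> \<Longrightarrow>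
      (\<lambda>n. (measure_pmf.expectation (S n) (g' n) - measure_pmf.expectation s (g' n)) /\<^sub>R t n) \<longlonglongrightarrow> pairing g b"
  shows "(\<lambda>n. (EROT lam c (R n) (S n) - EROT lam c r s) /\<^sub>R t n) \<longlonglongrightarrow> pairing \<alpha> a + pairing \<beta> b"
proof -
  interpret sw: erot_cost lam "\<lambda>y x. c x y" cYm' cYp' cXm' cXp' cYm cYp cXm cXp
    by (rule swap)
  let ?m = "measure_pmf.expectation r \<alpha>"
  note aR = admissible_convD(5)[OF R] and ar = admissible_convD(4)[OF R]
    and aS = admissible_convD(5)[OF S] and as = admissible_convD(4)[OF S]
  note S0 = admissible_conv_const[OF as]
  have "\<forall>n. \<exists>\<alpha> \<beta>. schrodinger lam c (R n) s \<alpha> \<beta> \<and> measure_pmf.expectation (R n) \<alpha> = ?m"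
    using exists_normalized_schrodinger[OF aR as] by metis
  then obtain \<alpha>1 \<beta>1 where sol1: "\<And>n. schrodinger lam c (R n) s (\<alpha>1 n) (\<beta>1 n)"
    and m1: "\<And>n. measure_pmf.expectation (R n) (\<alpha>1 n) = ?m"
    by metis
  have "\<forall>n. \<exists>\<alpha> \<beta>. schrodinger lam c (R n) (S n) \<alpha> \<beta> \<and> measure_pmf.expectation (R n) \<alpha> = ?m"
    using exists_normalized_schrodinger[OF aR aS] by metis
  then obtain \<alpha>2 \<beta>2 where sol2: "\<And>n. schrodinger lam c (R n) (S n) (\<alpha>2 n) (\<beta>2 n)"
    and m2: "\<And>n. measure_pmf.expectation (R n) (\<alpha>2 n) = ?m"
    by metis
  note st1 = schrodinger_stable[OF R S0 sol1 m1 sol] and st2 = schrodinger_stable[OF R S sol2 m2 sol]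
  obtain K1 where K1: "0 \<le> K1" "\<And>n x. \<bar>\<alpha>1 n x\<bar> \<le> K1 * abs_weight cXm cXp x" "\<And>n y. \<bar>\<beta>1 n y\<bar> \<le> K1 * abs_weight cYm' cYp' y"
    using st1(1) by blast
  obtain K2 where K2: "0 \<le> K2" "\<And>n y. \<bar>\<beta>2 n y\<bar> \<le> K2 * abs_weight cYm' cYp' y"
    using st2(1) by blast
  obtain K0 where K0: "0 \<le> K0" "\<And>x. \<bar>\<alpha> x\<bar> \<le> K0 * abs_weight cXm cXp x"
    using schrodinger_bounded[OF ar as sol] by metis
  let ?dX = "\<lambda>n f. measure_pmf.expectation (R n) f - measure_pmf.expectation r f"
    and ?dY = "\<lambda>n f. measure_pmf.expectation (S n) f - measure_pmf.expectation s f"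
  have V: "EROT lam c (R n) (S n) = measure_pmf.expectation (R n) (\<alpha>2 n) + measure_pmf.expectation (S n) (\<beta>2 n)"
    "EROT lam c r s = measure_pmf.expectation r \<alpha> + measure_pmf.expectation s \<beta>" for n
    using EROT_eq[OF aR aS sol2] EROT_eq[OF ar as sol] by blast+
  note swp = schrodinger_swap
  \<comment> \<open>Each leg is tested with the potentials of its starting point: \<alpha> on the
    first, \<open>\<beta>1 n\<close> on the second.\<close>
  have lo: "?dX n \<alpha> + ?dY n (\<beta>1 n) \<le> EROT lam c (R n) (S n) - EROT lam c r s" for n
    using schrodinger_value_mono[OF aR as aS sol1 sol2, of n]
      sw.schrodinger_value_mono[OF as ar aR swp[OF sol] swp[OF sol1], of n]
    unfolding V by linarith
  \<comment> \<open>Traversed backwards, each leg is tested with the potentials of its endpoint: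
    \<open>\<alpha>1 n\<close> on the first, \<open>\<beta>2 n\<close> on the second.\<close>
  have up: "EROT lam c (R n) (S n) - EROT lam c r s \<le> ?dX n (\<alpha>1 n) + ?dY n (\<beta>2 n)" for n
    using schrodinger_value_mono[OF aR aS as sol2 sol1, of n]
      sw.schrodinger_value_mono[OF as aR ar swp[OF sol1] swp[OF sol], of n]
    unfolding V by linarith
  show ?thesis
  proof (rule tendsto_sandwich)
    show "(\<lambda>n. ?dX n \<alpha> /\<^sub>R t n + ?dY n (\<beta>1 n) /\<^sub>R t n) \<longlonglongrightarrow> pairing \<alpha> a + pairing \<beta> b"
      by (intro tendsto_add a[where K = K0] b[where K = K1] K0 K1 st1 tendsto_const)
    show "(\<lambda>n. ?dX n (\<alpha>1 n) /\<^sub>R t n + ?dY n (\<beta>2 n) /\<^sub>R t n) \<longlonglongrightarrow> pairing \<alpha> a + pairing \<beta> b"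
      by (intro tendsto_add a[where K = K1] b[where K = K2] K1 K2 st1 st2)
    show "\<forall>\<^sub>F n in sequentially. ?dX n \<alpha> /\<^sub>R t n + ?dY n (\<beta>1 n) /\<^sub>R t n
        \<le> (EROT lam c (R n) (S n) - EROT lam c r s) /\<^sub>R t n"
      unfolding scaleR_add_right[symmetric] using lo t
      by (intro always_eventually allI scaleR_left_mono) (auto intro: less_imp_le)
    show "\<forall>\<^sub>F n in sequentially. (EROT lam c (R n) (S n) - EROT lam c r s) /\<^sub>R t n
        \<le> ?dX n (\<alpha>1 n) /\<^sub>R t n + ?dY n (\<beta>2 n) /\<^sub>R t n"
      unfolding scaleR_add_right[symmetric] using up t
      by (intro always_eventually allI scaleR_left_mono) (auto intro: less_imp_le)
  qed
qed

end

subsection \<open>Hadamard differentiability\<close>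

lemma bounded_linear_apply_bcontfun: "bounded_linear (\<lambda>h :: 'a::topological_space \<Rightarrow>\<^sub>C 'b::real_normed_vector. apply_bcontfun h x)"
  by (rule bounded_linear_intro[where K = 1]) (auto simp: norm_bounded)

context erot_cost
begin

lemma EROT_hadamard:
  fixes ex :: "nat \<Rightarrow> 'x" and ey :: "nat \<Rightarrow> 'y"
  defines "FX \<equiv> weight_class lam cXm cXp cXm' cXp' ex" and "FY \<equiv> weight_class lam cYm' cYp' cYm cYp ey"
  assumes r: "admX r" and s: "admY s" and sol: "schrodinger lam c r s \<alpha> \<beta>"
  shows "has_hadamard_derivative (EROT_functional lam c FX FY)
    (\<lambda>(hX, hY). pairing \<alpha> (signed_measure (abs_weight cXm cXp) hX)
      + pairing \<beta> (signed_measure (abs_weight cYm' cYp') hY))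
    (as_functional FX r, as_functional FY s) (prob_domain FX FY)"
proof -
  let ?CX = "abs_weight cXm cXp" and ?CY = "abs_weight cYm' cYp'"
  let ?u = "(as_functional FX r, as_functional FY s)"
  let ?D = "\<lambda>(hX, hY). pairing \<alpha> (signed_measure ?CX hX) + pairing \<beta> (signed_measure ?CY hY)"
  have rF: "r \<in> prob_linf FX" and sF: "s \<in> prob_linf FY"
    using r s by (simp_all add: FX_def FY_def prob_linf_weight_class)
  have inv: "EROT_functional lam c FX FY (as_functional FX r', as_functional FY s') = EROT lam c r' s'"
    if "r' \<in> prob_linf FX" "s' \<in> prob_linf FY" for r' s'
    using that inv_into_f_f[OF inj_on_as_functional that(1)] inv_into_f_f[OF inj_on_as_functional that(2)]
    by (simp add: EROT_functional_def FX_def FY_def weight_class_mem)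
  have split: "\<exists>R S. (\<forall>n. R n \<in> prob_linf FX \<and> S n \<in> prob_linf FY \<and> k n = (as_functional FX (R n), as_functional FY (S n)))
      \<and> (\<lambda>n. (as_functional FX (R n) - as_functional FX r) /\<^sub>R t n) \<longlonglongrightarrow> fst h
      \<and> (\<lambda>n. (as_functional FY (S n) - as_functional FY s) /\<^sub>R t n) \<longlonglongrightarrow> snd h"
    if k: "\<forall>n. k n \<in> prob_domain FX FY" and lim: "(\<lambda>n. (k n - ?u) /\<^sub>R t n) \<longlonglongrightarrow> h" for k t h
  proof -
    have "\<forall>n. \<exists>r' s'. r' \<in> prob_linf FX \<and> s' \<in> prob_linf FY \<and> k n = (as_functional FX r', as_functional FY s')"
      using k unfolding prob_domain_def by blast
    then obtain R S where RS: "\<And>n. R n \<in> prob_linf FX \<and> S n \<in> prob_linf FY \<and> k n = (as_functional FX (R n), as_functional FY (S n))"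
      by metis
    have "(\<lambda>n. fst ((k n - ?u) /\<^sub>R t n)) \<longlonglongrightarrow> fst h" "(\<lambda>n. snd ((k n - ?u) /\<^sub>R t n)) \<longlonglongrightarrow> snd h"
      using lim by (rule tendsto_fst, rule tendsto_snd)
    then show ?thesis
      using RS by (intro exI[of _ R] exI[of _ S]) simp
  qed
  note QX = functional_quotient[OF weight_class_mem(1)[where lam = lam and cm = cXm and cp = cXp and cm' = cXm' and cp' = cXp' and e = ex, folded FX_def] abs_weight_ge(1) rF]
    and QY = functional_quotient[OF weight_class_mem(1)[where lam = lam and cm = cYm' and cp = cYp' and cm' = cYm and cp' = cYp and e = ey, folded FY_def] abs_weight_ge(1) sF]
  have L: "\<exists>L. bounded_linear L \<and> (\<forall>h\<in>contingent_cone ?u (prob_domain FX FY). ?D h = L h)"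
  proof -
    obtain K where K0: "0 \<le> K" and K: "\<And>x. \<bar>\<alpha> x\<bar> \<le> K * ?CX x" "\<And>y. \<bar>\<beta> y\<bar> \<le> K * ?CY y"
      using schrodinger_bounded[OF r s sol] by metis
    \<comment> \<open>After rescaling, the potentials belong to the function classes, so on the cone
      the pairings are multiples of evaluations. Evaluations are continuous and linear on the whole
      space, which provides \<open>L\<close>.\<close>
    define f where "f = (\<lambda>x. \<alpha> x / (K + 1))"
    define g where "g = (\<lambda>y. \<beta> y / (K + 1))"
    have le: "\<bar>v / (K + 1)\<bar> \<le> w" if "\<bar>v\<bar> \<le> K * w" "0 \<le> w" for v w :: real
    proof -
      have "\<bar>v\<bar> \<le> (K + 1) * w"
        using that by (simp add: distrib_right)
      then show ?thesis
        using K0 by (simp add: pos_divide_le_eq mult.commute)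
    qed
    have f: "\<bar>f x\<bar> \<le> ?CX x" and g: "\<bar>g y\<bar> \<le> ?CY y" for x y
      unfolding f_def g_def by (rule le[OF K(1) abs_weight_nonneg], rule le[OF K(2) abs_weight_nonneg])
    define L where "L = (\<lambda>h. (K + 1) * (apply_bcontfun (fst h) (discrete f) + apply_bcontfun (snd h) (discrete g)))"
    have "bounded_linear L"
      unfolding L_def
      by (intro bounded_linear_const_mult bounded_linear_add
          bounded_linear_compose[OF bounded_linear_apply_bcontfun bounded_linear_fst]
          bounded_linear_compose[OF bounded_linear_apply_bcontfun bounded_linear_snd])
    moreover have "?D h = L h" if h: "h \<in> contingent_cone ?u (prob_domain FX FY)" for h
    proof -
      from h[unfolded contingent_cone_def mem_Collect_eq] obtain t k where
        tk: "decreases_to_zero t \<and> (\<forall>n. k n \<in> prob_domain FX FY) \<and> (\<lambda>n. (k n - ?u) /\<^sub>R t n) \<longlonglongrightarrow> h"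
        by (elim exE)
      from split[OF tk[THEN conjunct2, THEN conjunct1] tk[THEN conjunct2, THEN conjunct2]] obtain R S where R: "\<And>n. R n \<in> prob_linf FX" and S: "\<And>n. S n \<in> prob_linf FY"
        and lX: "(\<lambda>n. (as_functional FX (R n) - as_functional FX r) /\<^sub>R t n) \<longlonglongrightarrow> fst h"
        and lY: "(\<lambda>n. (as_functional FY (S n) - as_functional FY s) /\<^sub>R t n) \<longlonglongrightarrow> snd h"
        by blast
      have "(K + 1) * pairing (\<lambda>z. v z / (K + 1)) w = pairing v w" for v w :: "'z \<Rightarrow> real"
        using K0 by (simp add: pairing_eq_integral)
      note this[of \<alpha>] this[of \<beta>]
      then show ?thesis
        using QX(2)[OF R lX f] QY(2)[OF S lY g] K0
        by (simp add: L_def split_beta distrib_left pairing_eq_integral f_def g_def)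
    qed
    ultimately show ?thesis
      by blast
  qed
  have lim: "(\<lambda>n. norm ((EROT_functional lam c FX FY (?u + t n *\<^sub>R ((k n - ?u) /\<^sub>R t n)) - EROT_functional lam c FX FY ?u) /\<^sub>R t n
      - ?D h)) \<longlonglongrightarrow> 0"
    if dec: "decreases_to_zero t" and k: "\<forall>n. k n \<in> prob_domain FX FY" and kl: "(\<lambda>n. (k n - ?u) /\<^sub>R t n) \<longlonglongrightarrow> h" for t k h
  proof -
    have t: "0 < t n" for n
      using dec by (simp add: decreases_to_zero_def)
    have t0: "t \<longlonglongrightarrow> 0"
      using dec by (simp add: decreases_to_zero_def)
    from split[OF k kl] obtain R S where R: "\<And>n. R n \<in> prob_linf FX" and S: "\<And>n. S n \<in> prob_linf FY"
      and kRS: "\<And>n. k n = (as_functional FX (R n), as_functional FY (S n))"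
      and lX: "(\<lambda>n. (as_functional FX (R n) - as_functional FX r) /\<^sub>R t n) \<longlonglongrightarrow> fst h"
      and lY: "(\<lambda>n. (as_functional FY (S n) - as_functional FY s) /\<^sub>R t n) \<longlonglongrightarrow> snd h"
      by blast
    \<comment> \<open>Step sizes tending to zero and a convergent quotient force the numerators to
      vanish, so the marginals themselves converge and stability is available.\<close>
    have conv0: "v \<longlonglongrightarrow> w" if "(\<lambda>n. (v n - w) /\<^sub>R t n) \<longlonglongrightarrow> l" for v and w l :: "'z::real_normed_vector"
    proof (rule LIM_zero_cancel)
      have "(\<lambda>n. t n *\<^sub>R ((v n - w) /\<^sub>R t n)) \<longlonglongrightarrow> 0 *\<^sub>R l"
        by (rule tendsto_scaleR[OF t0 that])
      moreover have "t n *\<^sub>R ((v n - w) /\<^sub>R t n) = v n - w" for n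
        using t[of n] by simp
      ultimately show "(\<lambda>n. v n - w) \<longlonglongrightarrow> 0"
        by simp
    qed
    have cR: "convX R r"
      by (rule admissible_conv_of_functional[OF rF[unfolded FX_def] R[unfolded FX_def] conv0[OF lX, unfolded FX_def]])
    have cS: "convY S s"
      by (rule admissible_conv_of_functional[OF sF[unfolded FY_def] S[unfolded FY_def] conv0[OF lY, unfolded FY_def]])
    have k_eq: "?u + t n *\<^sub>R ((k n - ?u) /\<^sub>R t n) = k n" for n
      using t[of n] by simp
    have "(\<lambda>n. (EROT lam c (R n) (S n) - EROT lam c r s) /\<^sub>R t n)
        \<longlonglongrightarrow> pairing \<alpha> (signed_measure ?CX (fst h)) + pairing \<beta> (signed_measure ?CY (snd h))"
      using sol t cR cS QX(3)[OF R lX] QY(3)[OF S lY] by (rule EROT_quotient_tendsto)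
    from LIM_zero[OF this] show ?thesis
      unfolding k_eq unfolding kRS inv[OF R S] inv[OF rF sF] split_beta
      by (rule tendsto_norm_zero)
  qed
  have "?u \<in> prob_domain FX FY"
    using rF sF by (simp add: prob_domain_def)
  then show ?thesis
    unfolding has_hadamard_derivative_def using L lim by blast
qed

end

theorem theorem5p5:
  fixes lam :: real
    and c :: "'x::countable \<Rightarrow> 'y::countable \<Rightarrow> real"
    and cXm cXp cXm' cXp' :: "'x \<Rightarrow> real"
    and cYm cYp cYm' cYp' :: "'y \<Rightarrow> real"
    and ex :: "nat \<Rightarrow> 'x" and ey :: "nat \<Rightarrow> 'y"
    and r :: "'x pmf" and s :: "'y pmf"
  defines "CX \<equiv> abs_weight cXm cXp" and "CY \<equiv> abs_weight cYm cYp"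
    and "CX' \<equiv> abs_weight cXm' cXp'" and "CY' \<equiv> abs_weight cYm' cYp'"
    and "phiY \<equiv> exp_weight lam cYm cYp" and "phiX' \<equiv> exp_weight lam cXm' cXp'"
  defines "FX \<equiv> function_class CX CX' phiX' ex"
    and "FY \<equiv> function_class CY' CY phiY ey"
  assumes "lam > 0"
    and "range ex = UNIV" and "range ey = UNIV"
    and "dominating c cXm cXp cYm cYp"
    and "dominating c cXm' cXp' cYm' cYp'"
    and "CX \<in> ell1 (pmf r)" and "CX' \<in> ell1 (pmf r)" and "phiX' \<in> ell1 (pmf r)"
    and "CY \<in> ell1 (pmf s)" and "CY' \<in> ell1 (pmf s)" and "phiY \<in> ell1 (pmf s)"
  shows "(\<exists>\<alpha> \<beta>. EROT_potentials lam c r s \<alpha> \<beta>) \<and>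
    (\<forall>\<alpha> \<beta>. EROT_potentials lam c r s \<alpha> \<beta> \<longrightarrow>
       has_hadamard_derivative (EROT_functional lam c FX FY)
         (\<lambda>(hX, hY). pairing \<alpha> (signed_measure CX hX) + pairing \<beta> (signed_measure CY' hY))
         (as_functional FX r, as_functional FY s)
         (prob_domain FX FY))"
proof -
  interpret erot_cost lam c cXm cXp cYm cYp cXm' cXp' cYm' cYp'
    by unfold_locales fact+
  have r: "admX r"
    using assms(14-16) by (simp add: admissible_def mem_ell1_pmf CX_def CX'_def phiX'_def)
  have s: "admY s"
    using assms(17-19) by (simp add: admissible_def mem_ell1_pmf CY_def CY'_def phiY_def)
  obtain \<alpha>0 \<beta>0 where sol: "schrodinger lam c r s \<alpha>0 \<beta>0"
    using exists_schrodinger[OF r s] by blast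
  have "has_hadamard_derivative (EROT_functional lam c FX FY)
         (\<lambda>(hX, hY). pairing \<alpha> (signed_measure CX hX) + pairing \<beta> (signed_measure CY' hY))
         (as_functional FX r, as_functional FY s) (prob_domain FX FY)"
    if pot: "EROT_potentials lam c r s \<alpha> \<beta>" for \<alpha> \<beta>
  proof -
    \<comment> \<open>Any pair of potentials is a shift of the constructed solution, also off the
      supports, and thus solves the Schrodinger system itself. The derivative formula then holds for
      every choice of potentials.\<close>
    obtain \<eta> where \<eta>: "\<alpha> = (\<lambda>x. \<alpha>0 x + \<eta>)" "\<beta> = (\<lambda>y. \<beta>0 y - \<eta>)"
      by (rule EROT_potentials_unique[OF lam sol pot])
    have "schrodinger lam c r s \<alpha> \<beta>"
      unfolding \<eta> by (rule schrodinger_shift[OF sol])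
    from EROT_hadamard[OF r s this, of ex ey] show ?thesis
      by (simp only: FX_def FY_def CX_def CX'_def CY_def CY'_def phiX'_def phiY_def)
  qed
  then show ?thesis
    using schrodinger_EROT_potentials[OF lam sol] by blast
qed

end
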